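(* Let $\varepsilon\in\{-1,0,1\}$ and let $F:M^{n}\to\mathbb{Q}^{n+1}_{\varepsilon}$ be a connected oriented hypersurface with inward unit normal vector field $N$, i.e. such that the mean curvature with respect to $N$ satisfies $H(x)>0$ for all $x\in M$. Then $F(M)$ is an initial data of a solution to the inverse mean curvature flow (IMCF) by parallel hypersurfaces if and only if $F(M)$ is an isoparametric hypersurface. Moreover, for such a hypersurface, the solution to the IMCF by parallel hypersurfaces with initial data $F(M)$ is given by $$F^{t}(x)=C_{\varepsilon}(\mu(t))F(x)+S_{\varepsilon}(\mu(t))N(x),\qquad \forall (x,t)\in M\times I,$$ where $0\in I\subset\mathbb{R}$ and $\mu:I\to\mathbb{R}$ is a smooth real function satisfying $\mu(0)=0$ and $$\prod_{i=1}^{n}\bigl(C_{\varepsilon}(\mu(t))-k_{i}S_{\varepsilon}(\mu(t))\bigr)=e^{t},\qquad\forall t\in I,$$ where $k_i$, $i=1,\dots,n$, are the principal curvatures of $F(M)$ associated to $N$.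
   Context: $\mathbb{Q}^{n+1}_{\varepsilon}$ denotes the simply connected space form: the unit sphere $\mathbb{S}^{n+1}\subset\mathbb{E}^{n+2}$ if $\varepsilon=1$, the Euclidean space $\mathbb{E}^{n+1}$ if $\varepsilon=0$, and the hyperbolic space $\mathbb{H}^{n+1}=\{x\in\mathbb{L}^{n+2}: -x_1^2+\sum_{i=2}^{n+2}x_i^2=-1,\ x_1>0\}$ in Lorentz space $\mathbb{L}^{n+2}$ if $\varepsilon=-1$. Set $C_1(\mu)=\cos\mu$, $S_1(\mu)=\sin\mu$; $C_0(\mu)=1$, $S_0(\mu)=\mu$; $C_{-1}(\mu)=\cosh\mu$, $S_{-1}(\mu)=\sinh\mu$. For an oriented hypersurface $F:M^n\to\mathbb{Q}^{n+1}_\varepsilon$ (an immersion) with unit normal $N$, the second fundamental form is $II_x(v,w)=-\langle dN_x(v),dF_x(w)\rangle$, the principal curvatures $k_1,\dots,k_n$ are its eigenvalues with respect to the induced metric, and the mean curvature is $H=\sum_{i=1}^n k_i$ (not averaged). "Inward" normal means the choice of unit normal for which $H>0$. $F(M)$ is isoparametric if all its principal curvatures are constant on $M$. A one-parameter family of hypersurfaces $F^t:M\to\mathbb{Q}^{n+1}_\varepsilon$, $t\in I$, with $I\subset\mathbb{R}$ an open interval containing $0$, is a solution to the IMCF with initial data $F$ if $\frac{\partial F^t}{\partial t}(x)=-\frac{1}{H^t(x)}N^t(x)$ for all $(x,t)\in M\times I$ and $F^0=F$, where $H^t$ is the mean curvature of $F^t$ with respect to its inward unit normal $N^t$ and $H^t(x)>0$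 for all $(x,t)$. It is a solution by parallel hypersurfaces if there is a (smooth) function $\mu:I\to\mathbb{R}$ such that $F^t(x)=C_\varepsilon(\mu(t))F(x)+S_\varepsilon(\mu(t))N(x)$ for all $t\in I$, $x\in M$; the unit normal of $F^t$ is then $N^t(x)=-\varepsilon S_\varepsilon(\mu(t))F(x)+C_\varepsilon(\mu(t))N(x)$. *)

theory Defs
  imports "HOL-Analysis.Analysis" "HOL-Library.Multiset"
begin

section \<open>Smooth maps and smooth manifolds\<close>

text \<open>\<open>Ck_on k S f\<close> is meant for open \<open>S\<close> in a finite-dimensional space, where it says that
  \<open>f\<close> is \<open>k\<close> times continuously differentiable on \<open>S\<close>.\<close>

primrec Ck_on ::
  "nat \<Rightarrow> 'a::real_normed_vector set \<Rightarrow> ('a \<Rightarrow> 'b::real_normed_vector) \<Rightarrow> bool" where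
  "Ck_on 0 S f \<longleftrightarrow> continuous_on S f"
| "Ck_on (Suc k) S f \<longleftrightarrow>
     (\<forall>x\<in>S. f differentiable (at x)) \<and> (\<forall>v. Ck_on k S (\<lambda>x. frechet_derivative f (at x) v))"

definition smooth_on ::
  "'a::real_normed_vector set \<Rightarrow> ('a \<Rightarrow> 'b::real_normed_vector) \<Rightarrow> bool" where
  "smooth_on S f \<longleftrightarrow> (\<forall>k. Ck_on k S f)"

text \<open>A chart is a domain together with a coordinate map, whose values outside the domain are
  irrelevant. The manifold is the whole type \<open>'m\<close>, Hausdorff and second countable by its
  sort, and of dimension \<open>CARD('n)\<close>.\<close>

type_synonym ('m, 'n) chart = "'m set \<times> ('m \<Rightarrow> real^'n)"

definition chart_inv :: "('m, 'n) chart \<Rightarrow> real^'n \<Rightarrow> 'm" where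
  "chart_inv c = inv_into (fst c) (snd c)"

definition smooth_atlas ::
  "('m::{t2_space,second_countable_topology}, 'n::finite) chart set \<Rightarrow> bool" where
  "smooth_atlas A \<longleftrightarrow>
     (\<forall>c\<in>A. open (fst c) \<and> open (snd c ` fst c) \<and>
        homeomorphism (fst c) (snd c ` fst c) (snd c) (chart_inv c)) \<and>
     (\<Union>c\<in>A. fst c) = UNIV \<and>
     (\<forall>c\<in>A. \<forall>d\<in>A. smooth_on (snd c ` (fst c \<inter> fst d)) (snd d \<circ> chart_inv c))"

definition smooth_map ::
  "('m, 'n::finite) chart set \<Rightarrow> ('m \<Rightarrow> 'b::real_normed_vector) \<Rightarrow> bool" where
  "smooth_map A f \<longleftrightarrow> (\<forall>c\<in>A. smooth_on (snd c ` fst c) (f \<circ> chart_inv c))"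

text \<open>The tangent space at \<open>x\<close> is identified with \<open>real^'n\<close> through one chosen chart around
  \<open>x\<close>. Another choice composes the differentials at \<open>x\<close> of all maps with the same linear
  automorphism of \<open>real^'n\<close>, so the notions below do not depend on it.\<close>

definition chart_at :: "('m, 'n) chart set \<Rightarrow> 'm \<Rightarrow> ('m, 'n) chart" where
  "chart_at A x = (SOME c. c \<in> A \<and> x \<in> fst c)"

definition differential ::
  "('m, 'n::finite) chart set \<Rightarrow> ('m \<Rightarrow> 'b::real_normed_vector) \<Rightarrow> 'm \<Rightarrow> real^'n \<Rightarrow> 'b" where
  "differential A f x =
     frechet_derivative (f \<circ> chart_inv (chart_at A x)) (at (snd (chart_at A x) x))"


section \<open>Space forms\<close>

text \<open>The ambient flat space is \<open>real^'q\<close>. The index \<open>p\<close> marks the timelike coordinate of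
  Lorentz space; it plays no role unless \<open>\<epsilon> = -1\<close>.\<close>

definition ambient_form :: "real \<Rightarrow> 'q::finite \<Rightarrow> real^'q \<Rightarrow> real^'q \<Rightarrow> real" where
  "ambient_form \<epsilon> p v w =
     (if \<epsilon> = -1 then - (v $ p * w $ p) + (\<Sum>i\<in>UNIV - {p}. v $ i * w $ i) else v \<bullet> w)"

definition space_form :: "real \<Rightarrow> 'q::finite \<Rightarrow> (real^'q) set" where
  "space_form \<epsilon> p =
     (if \<epsilon> = 1 then sphere 0 1
      else if \<epsilon> = 0 then UNIV
      else {x. ambient_form (-1) p x x = -1 \<and> x $ p > 0})"

definition C_eps :: "real \<Rightarrow> real \<Rightarrow> real" where
  "C_eps \<epsilon> \<mu> = (if \<epsilon> = 1 then cos \<mu> else if \<epsilon> = 0 then 1 else cosh \<mu>)"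

definition S_eps :: "real \<Rightarrow> real \<Rightarrow> real" where
  "S_eps \<epsilon> \<mu> = (if \<epsilon> = 1 then sin \<mu> else if \<epsilon> = 0 then \<mu> else sinh \<mu>)"


section \<open>Hypersurfaces and their curvatures\<close>

definition hypersurface ::
  "real \<Rightarrow> 'q::finite \<Rightarrow> ('m, 'n::finite) chart set \<Rightarrow> ('m \<Rightarrow> real^'q) \<Rightarrow> bool" where
  "hypersurface \<epsilon> p A F \<longleftrightarrow>
     smooth_map A F \<and> (\<forall>x. F x \<in> space_form \<epsilon> p) \<and> (\<forall>x. inj (differential A F x))"

text \<open>For \<open>\<epsilon> \<noteq> 0\<close>, orthogonality to the position vector expresses tangency to the space form.\<close>

definition unit_normal ::
  "real \<Rightarrow> 'q::finite \<Rightarrow> ('m, 'n::finite) chart set \<Rightarrow> ('m \<Rightarrow> real^'q) \<Rightarrow> ('m \<Rightarrow> real^'q) \<Rightarrow> bool"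
  where
  "unit_normal \<epsilon> p A F N \<longleftrightarrow>
     smooth_map A N \<and>
     (\<forall>x. (\<epsilon> \<noteq> 0 \<longrightarrow> ambient_form \<epsilon> p (N x) (F x) = 0) \<and>
          ambient_form \<epsilon> p (N x) (N x) = 1 \<and>
          (\<forall>v. ambient_form \<epsilon> p (N x) (differential A F x v) = 0))"

definition first_form ::
  "real \<Rightarrow> 'q::finite \<Rightarrow> ('m, 'n::finite) chart set \<Rightarrow> ('m \<Rightarrow> real^'q) \<Rightarrow>
   'm \<Rightarrow> real^'n \<Rightarrow> real^'n \<Rightarrow> real" where
  "first_form \<epsilon> p A F x v w = ambient_form \<epsilon> p (differential A F x v) (differential A F x w)"

definition second_form ::
  "real \<Rightarrow> 'q::finite \<Rightarrow> ('m, 'n::finite) chart set \<Rightarrow> ('m \<Rightarrow> real^'q) \<Rightarrow> ('m \<Rightarrow> real^'q) \<Rightarrow>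
   'm \<Rightarrow> real^'n \<Rightarrow> real^'n \<Rightarrow> real" where
  "second_form \<epsilon> p A F N x v w =
     - ambient_form \<epsilon> p (differential A N x v) (differential A F x w)"

text \<open>The eigenspace of the second fundamental form with respect to the induced metric.\<close>

definition curvature_eigenspace ::
  "real \<Rightarrow> 'q::finite \<Rightarrow> ('m, 'n::finite) chart set \<Rightarrow> ('m \<Rightarrow> real^'q) \<Rightarrow> ('m \<Rightarrow> real^'q) \<Rightarrow>
   'm \<Rightarrow> real \<Rightarrow> (real^'n) set" where
  "curvature_eigenspace \<epsilon> p A F N x k =
     {v. \<forall>w. second_form \<epsilon> p A F N x v w = k * first_form \<epsilon> p A F x v w}"

text \<open>The principal curvatures \<open>k\<^sub>1, \<dots>, k\<^sub>n\<close> at \<open>x\<close>, as a multiset, every eigenvalue being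
  counted with the dimension of its eigenspace.\<close>

definition principal_curvatures ::
  "real \<Rightarrow> 'q::finite \<Rightarrow> ('m, 'n::finite) chart set \<Rightarrow> ('m \<Rightarrow> real^'q) \<Rightarrow> ('m \<Rightarrow> real^'q) \<Rightarrow>
   'm \<Rightarrow> real multiset" where
  "principal_curvatures \<epsilon> p A F N x =
     (\<Sum>k | curvature_eigenspace \<epsilon> p A F N x k \<noteq> {0}.
        replicate_mset (dim (curvature_eigenspace \<epsilon> p A F N x k)) k)"

definition mean_curvature ::
  "real \<Rightarrow> 'q::finite \<Rightarrow> ('m, 'n::finite) chart set \<Rightarrow> ('m \<Rightarrow> real^'q) \<Rightarrow> ('m \<Rightarrow> real^'q) \<Rightarrow>
   'm \<Rightarrow> real" where
  "mean_curvature \<epsilon> p A F N x = (\<Sum>k\<in>#principal_curvatures \<epsilon> p A F N x. k)"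

definition inward_unit_normal ::
  "real \<Rightarrow> 'q::finite \<Rightarrow> ('m, 'n::finite) chart set \<Rightarrow> ('m \<Rightarrow> real^'q) \<Rightarrow> ('m \<Rightarrow> real^'q) \<Rightarrow> bool"
  where
  "inward_unit_normal \<epsilon> p A F N \<longleftrightarrow>
     unit_normal \<epsilon> p A F N \<and> (\<forall>x. mean_curvature \<epsilon> p A F N x > 0)"

definition isoparametric ::
  "real \<Rightarrow> 'q::finite \<Rightarrow> ('m, 'n::finite) chart set \<Rightarrow> ('m \<Rightarrow> real^'q) \<Rightarrow> ('m \<Rightarrow> real^'q) \<Rightarrow> bool"
  where
  "isoparametric \<epsilon> p A F N \<longleftrightarrow>
     (\<forall>x y. principal_curvatures \<epsilon> p A F N x = principal_curvatures \<epsilon> p A F N y)"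


section \<open>Inverse mean curvature flow\<close>

definition open_interval_around_0 :: "real set \<Rightarrow> bool" where
  "open_interval_around_0 I \<longleftrightarrow> open I \<and> is_interval I \<and> 0 \<in> I"

text \<open>The inward unit normal of a hypersurface is unique when it exists, so the existential
  quantifier over \<open>Nt\<close> only names it.\<close>

definition IMCF_solution ::
  "real \<Rightarrow> 'q::finite \<Rightarrow> ('m, 'n::finite) chart set \<Rightarrow> ('m \<Rightarrow> real^'q) \<Rightarrow>
   real set \<Rightarrow> (real \<Rightarrow> 'm \<Rightarrow> real^'q) \<Rightarrow> bool" where
  "IMCF_solution \<epsilon> p A F I Ft \<longleftrightarrow>
     open_interval_around_0 I \<and> Ft 0 = F \<and>
     (\<forall>t\<in>I. hypersurface \<epsilon> p A (Ft t) \<and>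
        (\<exists>Nt. inward_unit_normal \<epsilon> p A (Ft t) Nt \<and>
           (\<forall>x. ((\<lambda>s. Ft s x) has_vector_derivative
                  - (1 / mean_curvature \<epsilon> p A (Ft t) Nt x) *\<^sub>R Nt x) (at t))))"

definition parallel_family ::
  "real \<Rightarrow> ('m \<Rightarrow> real^'q) \<Rightarrow> ('m \<Rightarrow> real^'q) \<Rightarrow> real set \<Rightarrow> (real \<Rightarrow> real) \<Rightarrow>
   (real \<Rightarrow> 'm \<Rightarrow> real^'q) \<Rightarrow> bool" where
  "parallel_family \<epsilon> F N I \<mu> Ft \<longleftrightarrow>
     smooth_on I \<mu> \<and>
     (\<forall>t\<in>I. \<forall>x. Ft t x = C_eps \<epsilon> (\<mu> t) *\<^sub>R F x + S_eps \<epsilon> (\<mu> t) *\<^sub>R N x)"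

definition IMCF_solution_by_parallel ::
  "real \<Rightarrow> 'q::finite \<Rightarrow> ('m, 'n::finite) chart set \<Rightarrow> ('m \<Rightarrow> real^'q) \<Rightarrow> ('m \<Rightarrow> real^'q) \<Rightarrow>
   real set \<Rightarrow> (real \<Rightarrow> 'm \<Rightarrow> real^'q) \<Rightarrow> bool" where
  "IMCF_solution_by_parallel \<epsilon> p A F N I Ft \<longleftrightarrow>
     IMCF_solution \<epsilon> p A F I Ft \<and> (\<exists>\<mu>. parallel_family \<epsilon> F N I \<mu> Ft)"

end

theory Submission
  imports Defs
begin

text \<open>
  Write \<open>C\<close>, \<open>S\<close> for the two functions of the space form, so that \<open>C' = - \<epsilon> S\<close>, \<open>S' = C\<close> and
  \<open>C\<^sup>2 + \<epsilon> S\<^sup>2 = 1\<close>. The parallel map \<open>C(m) F + S(m) N\<close> has differential \<open>C dF + S dN\<close>, and on a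
  principal direction with \<open>dN = - k dF\<close> this is \<open>(C - k S) dF\<close>. Hence the parallel map is an
  immersion iff no factor \<open>C - k S\<close> vanishes, its principal curvatures are
  \<open>(k C + \<epsilon> S) / (C - k S)\<close> with unchanged principal directions (\<open>curvatures_parallel\<close>), and the
  product \<open>J = \<Prod> (C - k S)\<close> satisfies \<open>dJ/dm = - H J\<close>, where \<open>H\<close> is the mean curvature of the
  parallel hypersurface.

  A parallel family with parameter \<open>\<mu>(t)\<close> moves with velocity \<open>\<mu>'\<close> times its unit normal. It
  therefore solves the flow iff \<open>\<mu>' H = -1\<close> at every point and time
  (\<open>parallel_flow_equation_iff\<close>), and by the derivative of \<open>J\<close> this is the linear equation
  \<open>d/dt J(\<mu>(t)) = J(\<mu>(t))\<close>. As \<open>J = 1\<close> at time \<open>0\<close>, the flow equation is equivalent to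
  \<open>J(\<mu>(t)) = e\<^sup>t\<close> at every point (\<open>IMCF_solution_iff_jacobian\<close>).

  If a solution exists, the function \<open>J \<circ> \<mu>\<close> is thus the same at all points. Now \<open>J / S\<^sup>n\<close> is
  the monic polynomial with roots \<open>k\<^sub>1, \<dots>, k\<^sub>n\<close>, evaluated at \<open>C / S\<close>, which takes infinitely many
  values along \<open>\<mu>\<close>; so the polynomials, and with them the principal curvatures, agree at all
  points (\<open>multiset_eq_if_parallel_jacobians_agree\<close>). This uses that there are exactly \<open>n\<close>
  principal curvatures, that is, the symmetry of the second fundamental form and the spectral
  theorem. Conversely, if the curvatures are constant then \<open>J\<close> is one function of \<open>m\<close> with
  \<open>J(0) = 1\<close> and \<open>J'(0) = - H < 0\<close>, and \<open>\<mu>(t) = J\<^sup>-\<^sup>1(e\<^sup>t)\<close> near \<open>t = 0\<close> gives a solution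
  (\<open>parallel_jacobian_parametrization\<close>).
\<close>

section \<open>Smooth maps\<close>

lemma Ck_on_cong:
  assumes "open S" "\<And>x. x \<in> S \<Longrightarrow> f x = g x" "Ck_on k S f"
  shows "Ck_on k S g"
  using assms(2,3)
proof (induction k arbitrary: f g)
  case 0
  then show ?case using continuous_on_eq[of S f g] by simp
next
  case (Suc k)
  have d: "g differentiable (at x)" if "x \<in> S" for x
  proof -
    have "(f has_derivative frechet_derivative f (at x)) (at x)"
      using Suc.prems(2) that frechet_derivative_works by auto
    from has_derivative_transform_within_open[OF this assms(1) that Suc.prems(1)]
    show ?thesis by (rule differentiableI)
  qed
  have fg: "frechet_derivative f (at x) = frechet_derivative g (at x)" if "x \<in> S" for x
    by (rule frechet_derivative_transform_within_open[OF _ assms(1) that]) (use Suc.prems that in auto)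
  have "Ck_on k S (\<lambda>x. frechet_derivative g (at x) v)" for v
  proof (rule Suc.IH)
    show "Ck_on k S (\<lambda>x. frechet_derivative f (at x) v)" using Suc.prems(2) by simp
  qed (simp add: fg)
  then show ?case using d by simp
qed

lemma frechet_derivative_linear_combination:
  assumes "f differentiable (at x)" "g differentiable (at x)"
  shows "(\<lambda>x. a *\<^sub>R f x + b *\<^sub>R g x) differentiable (at x)"
    and "frechet_derivative (\<lambda>x. a *\<^sub>R f x + b *\<^sub>R g x) (at x) v =
      a *\<^sub>R frechet_derivative f (at x) v + b *\<^sub>R frechet_derivative g (at x) v"
proof -
  have D: "((\<lambda>x. a *\<^sub>R f x + b *\<^sub>R g x) has_derivative
      (\<lambda>v. a *\<^sub>R frechet_derivative f (at x) v + b *\<^sub>R frechet_derivative g (at x) v)) (at x)"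
    using assms[unfolded frechet_derivative_works] by (auto intro!: derivative_intros)
  then show "(\<lambda>x. a *\<^sub>R f x + b *\<^sub>R g x) differentiable (at x)"
    and "frechet_derivative (\<lambda>x. a *\<^sub>R f x + b *\<^sub>R g x) (at x) v =
      a *\<^sub>R frechet_derivative f (at x) v + b *\<^sub>R frechet_derivative g (at x) v"
    using differentiableI[OF D] frechet_derivative_at[OF D, symmetric] by simp_all
qed

lemma Ck_on_linear_combination:
  assumes "open S" "Ck_on k S f" "Ck_on k S g"
  shows "Ck_on k S (\<lambda>x. a *\<^sub>R f x + b *\<^sub>R g x)"
  using assms(2,3)
proof (induction k arbitrary: f g)
  case 0
  then show ?case by (auto intro!: continuous_intros)
next
  case (Suc k)
  have "Ck_on k S (\<lambda>x. frechet_derivative (\<lambda>x. a *\<^sub>R f x + b *\<^sub>R g x) (at x) v)" for v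
  proof (rule Ck_on_cong[OF assms(1)])
    show "Ck_on k S (\<lambda>x. a *\<^sub>R frechet_derivative f (at x) v + b *\<^sub>R frechet_derivative g (at x) v)"
      using Suc by auto
  qed (use Suc.prems in \<open>auto simp: frechet_derivative_linear_combination(2)\<close>)
  then show ?case using Suc.prems frechet_derivative_linear_combination(1) by auto
qed

lemma smooth_on_linear_combination:
  "open S \<Longrightarrow> smooth_on S f \<Longrightarrow> smooth_on S g \<Longrightarrow> smooth_on S (\<lambda>x. a *\<^sub>R f x + b *\<^sub>R g x)"
  by (simp add: smooth_on_def Ck_on_linear_combination)

lemma smooth_on_differentiable: "smooth_on S f \<Longrightarrow> x \<in> S \<Longrightarrow> f differentiable (at x)"
  unfolding smooth_on_def using Ck_on.simps(2)[of 0 S f] by blast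

lemma smooth_on_frechet_derivative:
  "smooth_on S f \<Longrightarrow> smooth_on S (\<lambda>x. frechet_derivative f (at x) v)"
  unfolding smooth_on_def by (metis Ck_on.simps(2))

lemma smooth_on_continuous: "smooth_on S f \<Longrightarrow> continuous_on S f"
  unfolding smooth_on_def by (metis Ck_on.simps(1))

text \<open>By induction on \<open>k\<close>, every member of such a family is \<open>k\<close> times continuously differentiable.
  This shows a function to be smooth from its first derivative alone, once that derivative is
  expressed through functions of the same kind.\<close>

lemma smooth_on_if_closed_under_derivatives:
  fixes \<A> :: "(real \<Rightarrow> real) set"
  assumes "open I"
    and "\<And>f. f \<in> \<A> \<Longrightarrow> \<exists>f'\<in>\<A>. \<forall>t\<in>I. (f has_real_derivative f' t) (at t)"
    and "f \<in> \<A>"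
  shows "smooth_on I f"
proof -
  have "Ck_on k I f" for k
    using assms(3)
  proof (induction k arbitrary: f)
    case 0
    then obtain f' where "\<forall>t\<in>I. (f has_real_derivative f' t) (at t)" using assms(2) by blast
    then show ?case 
      using DERIV_isCont continuous_at_imp_continuous_on[of I f] by (metis Ck_on.simps(1))
  next
    case (Suc k)
    then obtain f' where f': "f' \<in> \<A>" "\<forall>t\<in>I. (f has_real_derivative f' t) (at t)"
      using assms(2) by blast
    have fd: "frechet_derivative f (at t) v = f' t * v" if "t \<in> I" for t v
      using frechet_derivative_at[OF f'(2)[rule_format, OF that, unfolded has_field_derivative_def]]
      by metis
    have "Ck_on k I (\<lambda>t. frechet_derivative f (at t) v)" for v
    proof (rule Ck_on_cong[OF assms(1)])
      show "Ck_on k I (\<lambda>t. v *\<^sub>R f' t + 0 *\<^sub>R f' t)"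
        by (intro Ck_on_linear_combination assms(1) Suc.IH f')
    qed (simp add: fd)
    then show ?case using f' by (auto simp: has_field_derivative_def intro: differentiableI)
  qed
  then show ?thesis by (simp add: smooth_on_def)
qed

lemma directional_derivative:
  fixes h :: "'a::real_normed_vector \<Rightarrow> real"
  assumes "h differentiable (at (a + s *\<^sub>R v))"
  shows "((\<lambda>s. h (a + s *\<^sub>R v)) has_real_derivative frechet_derivative h (at (a + s *\<^sub>R v)) v) (at s)"
proof -
  have 1: "((\<lambda>s. a + s *\<^sub>R v) has_derivative (\<lambda>s. s *\<^sub>R v)) (at s)"
    by (auto intro!: derivative_eq_intros)
  have "(h has_derivative frechet_derivative h (at (a + s *\<^sub>R v))) (at (a + s *\<^sub>R v))"
    using assms frechet_derivative_works by blast
  from has_derivative_compose[OF 1 this] show ?thesis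
    unfolding has_field_derivative_def
    using linear_frechet_derivative[OF assms] by (simp add: linear_cmul mult.commute[of _ "frechet_derivative h _ v"])
qed

text \<open>The second difference over the parallelogram with sides \<open>r v\<close> and \<open>r w\<close> does not depend on the
  order of \<open>v\<close> and \<open>w\<close>, while two applications of the mean value theorem, along \<open>v\<close> and then along
  \<open>w\<close>, turn it into a mixed second derivative at a nearby point.\<close>

lemma second_difference_mean_value:
  fixes h :: "'a::real_normed_vector \<Rightarrow> real"
  assumes "smooth_on (ball x e) h" "r > 0" "r * (norm v + norm w) < e"
  obtains y where "dist x y \<le> r * (norm v + norm w)"
    "h (x + r *\<^sub>R v + r *\<^sub>R w) - h (x + r *\<^sub>R v) - h (x + r *\<^sub>R w) + h x
      = r\<^sup>2 * frechet_derivative (\<lambda>z. frechet_derivative h (at z) v) (at y) w"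
proof -
  let ?d = "\<lambda>z. frechet_derivative h (at z) v"
  have near: "norm (s *\<^sub>R v + t *\<^sub>R w) \<le> r * (norm v + norm w)"
    if "0 \<le> s" "s \<le> r" "0 \<le> t" "t \<le> r" for s t
  proof -
    have "norm (s *\<^sub>R v + t *\<^sub>R w) \<le> s * norm v + t * norm w"
      using that norm_triangle_ineq[of "s *\<^sub>R v" "t *\<^sub>R w"] by simp
    also have "\<dots> \<le> r * norm v + r * norm w"
      using that by (intro add_mono mult_right_mono) auto
    finally show ?thesis by (simp add: algebra_simps)
  qed
  have inb: "x + s *\<^sub>R v + t *\<^sub>R w \<in> ball x e" if "0 \<le> s" "s \<le> r" "0 \<le> t" "t \<le> r" for s t
  proof -
    have "dist x (x + s *\<^sub>R v + t *\<^sub>R w) = norm (s *\<^sub>R v + t *\<^sub>R w)"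
      by (simp add: dist_norm add.assoc flip: norm_minus_cancel[of "_ + _"])
    then show ?thesis using near[OF that] assms(3) by simp
  qed
  have dh: "h differentiable (at (x + s *\<^sub>R v + t *\<^sub>R w))" 
    and dd: "?d differentiable (at (x + s *\<^sub>R v + t *\<^sub>R w))" 
    if "0 \<le> s" "s \<le> r" "0 \<le> t" "t \<le> r" for s t
    using smooth_on_differentiable[OF assms(1) inb[OF that]]
      smooth_on_differentiable[OF smooth_on_frechet_derivative[OF assms(1)] inb[OF that]] by auto
  have "\<exists>s. 0 < s \<and> s < r \<and> (h (x + r *\<^sub>R w + r *\<^sub>R v) - h (x + r *\<^sub>R v)) - (h (x + r *\<^sub>R w + 0 *\<^sub>R v) - h (x + 0 *\<^sub>R v))
     = (r - 0) * (?d (x + r *\<^sub>R w + s *\<^sub>R v) - ?d (x + s *\<^sub>R v))"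
  proof (rule MVT2[OF assms(2)])
    fix s assume s: "0 \<le> s" "s \<le> r"
    show "((\<lambda>s. h (x + r *\<^sub>R w + s *\<^sub>R v) - h (x + s *\<^sub>R v)) has_real_derivative
       ?d (x + r *\<^sub>R w + s *\<^sub>R v) - ?d (x + s *\<^sub>R v)) (at s)"
      using dh[OF s, of r] dh[OF s, of 0] assms(2)
      by (intro derivative_intros directional_derivative) (auto simp: algebra_simps)
  qed
  then obtain s where s: "0 < s" "s < r" and
    1: "(h (x + r *\<^sub>R w + r *\<^sub>R v) - h (x + r *\<^sub>R v)) - (h (x + r *\<^sub>R w) - h x)
     = r * (?d (x + r *\<^sub>R w + s *\<^sub>R v) - ?d (x + s *\<^sub>R v))" by auto
  have "\<exists>t. 0 < t \<and> t < r \<and> ?d (x + s *\<^sub>R v + r *\<^sub>R w) - ?d (x + s *\<^sub>R v + 0 *\<^sub>R w)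
     = (r - 0) * frechet_derivative ?d (at (x + s *\<^sub>R v + t *\<^sub>R w)) w"
    by (rule MVT2[OF assms(2)]) (use dd s in \<open>auto intro!: directional_derivative\<close>)
  then obtain t where t: "0 < t" "t < r" and
    2: "?d (x + s *\<^sub>R v + r *\<^sub>R w) - ?d (x + s *\<^sub>R v)
     = r * frechet_derivative ?d (at (x + s *\<^sub>R v + t *\<^sub>R w)) w" by auto
  show thesis
  proof (rule that[of "x + s *\<^sub>R v + t *\<^sub>R w"])
    show "dist x (x + s *\<^sub>R v + t *\<^sub>R w) \<le> r * (norm v + norm w)"
      using near[of s t] s t by (simp add: dist_norm add.assoc flip: norm_minus_cancel[of "_ + _"])
    show "h (x + r *\<^sub>R v + r *\<^sub>R w) - h (x + r *\<^sub>R v) - h (x + r *\<^sub>R w) + h x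
      = r\<^sup>2 * frechet_derivative ?d (at (x + s *\<^sub>R v + t *\<^sub>R w)) w"
      using 1 2 by (simp add: power2_eq_square add_ac)
  qed
qed

text \<open>Both mixed derivatives are the limit, as \<open>r\<close> tends to \<open>0\<close>, of the same second difference divided
  by \<open>r\<^sup>2\<close>.\<close>

lemma symmetric_second_derivative_real:
  fixes h :: "'a::real_normed_vector \<Rightarrow> real"
  assumes "open S" "x \<in> S" "smooth_on S h"
  shows "frechet_derivative (\<lambda>z. frechet_derivative h (at z) v) (at x) w =
    frechet_derivative (\<lambda>z. frechet_derivative h (at z) w) (at x) v"
proof -
  let ?A = "\<lambda>y. frechet_derivative (\<lambda>z. frechet_derivative h (at z) v) (at y) w"
  let ?B = "\<lambda>y. frechet_derivative (\<lambda>z. frechet_derivative h (at z) w) (at y) v"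
  obtain e where e: "e > 0" "ball x e \<subseteq> S" using assms(1,2) openE by blast
  have sm: "smooth_on (ball x e) h"
  proof -
    have "Ck_on k S f \<Longrightarrow> T \<subseteq> S \<Longrightarrow> Ck_on k T f" for k T and f :: "'a \<Rightarrow> real"
      by (induction k arbitrary: f) (auto intro: continuous_on_subset)
    then show ?thesis using assms(3) e by (auto simp: smooth_on_def)
  qed
  \<comment> \<open>Radii that shrink to \<open>0\<close> and keep the parallelograms inside the ball; the summand \<open>1\<close> keeps
    \<open>c\<close> positive when \<open>v = w = 0\<close>.\<close>
  define c where "c = norm v + norm w + 1"
  have c: "c > 0" by (simp add: c_def add_nonneg_pos)
  define r where "r n = e / c / 2 ^ Suc n" for n :: nat
  have r0: "r n > 0" for n using e c by (simp add: r_def)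
  have rlim: "r \<longlonglongrightarrow> 0" unfolding r_def by (intro LIMSEQ_Suc LIMSEQ_divide_realpow_zero) simp
  have rc: "r n * (norm v + norm w) < e" "r n * (norm v + norm w) \<le> r n * c" for n
  proof -
    show "r n * (norm v + norm w) \<le> r n * c" using r0[of n] by (simp add: c_def)
    also have "\<dots> = e / 2 ^ Suc n" using c by (simp add: r_def)
    also have "\<dots> < e" using e one_less_power[of "2::real" "Suc n"] by (simp add: divide_less_eq)
    finally show "r n * (norm v + norm w) < e" .
  qed
  have "\<exists>y z. dist x y \<le> r n * c \<and> dist x z \<le> r n * c \<and> ?A y = ?B z" for n
  proof -
    obtain y where y: "dist x y \<le> r n * (norm v + norm w)"
      "h (x + r n *\<^sub>R v + r n *\<^sub>R w) - h (x + r n *\<^sub>R v) - h (x + r n *\<^sub>R w) + h x = (r n)\<^sup>2 * ?A y"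
      using second_difference_mean_value[OF sm r0 rc(1)] by blast
    have "r n * (norm w + norm v) < e" using rc(1)[of n] by (simp add: add.commute)
    then obtain z where z: "dist x z \<le> r n * (norm w + norm v)"
      "h (x + r n *\<^sub>R w + r n *\<^sub>R v) - h (x + r n *\<^sub>R w) - h (x + r n *\<^sub>R v) + h x = (r n)\<^sup>2 * ?B z"
      using second_difference_mean_value[OF sm r0] by blast
    have "(r n)\<^sup>2 * ?A y = (r n)\<^sup>2 * ?B z" 
      using y(2)[symmetric] z(2)[symmetric] by (simp add: add_ac)
    then have "?A y = ?B z" using r0[of n] by simp
    then show ?thesis using y(1) z(1) rc(2)[of n] by (intro exI[of _ y] exI[of _ z]) (auto simp: add.commute)
  qed
  then obtain Y Z where YZ: "\<And>n. dist x (Y n) \<le> r n * c" "\<And>n. dist x (Z n) \<le> r n * c" "\<And>n. ?A (Y n) = ?B (Z n)"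
    by metis
  have lim: "X \<longlonglongrightarrow> x" if "\<And>n. dist x (X n) \<le> r n * c" for X :: "nat \<Rightarrow> 'a"
  proof -
    have le: "\<forall>n. norm (dist (X n) x) \<le> r n * c" using that by (simp add: dist_commute)
    have "(\<lambda>n. dist (X n) x) \<longlonglongrightarrow> 0"
      by (rule Lim_null_comparison[OF always_eventually[OF le] tendsto_mult_left_zero[OF rlim]])
    then show ?thesis by (subst tendsto_dist_iff)
  qed
  have cont: "isCont (\<lambda>y. frechet_derivative (\<lambda>z. frechet_derivative h (at z) a) (at y) b) x" for a b
  proof -
    have "continuous_on S (\<lambda>y. frechet_derivative (\<lambda>z. frechet_derivative h (at z) a) (at y) b)"
      by (intro smooth_on_continuous smooth_on_frechet_derivative assms(3))
    then show ?thesis using assms(1,2) by (simp add: continuous_on_eq_continuous_at)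
  qed
  have "(\<lambda>n. ?A (Y n)) \<longlonglongrightarrow> ?A x" "(\<lambda>n. ?B (Z n)) \<longlonglongrightarrow> ?B x"
    by (intro isCont_tendsto_compose[OF cont] lim YZ)+
  then show ?thesis using YZ(3) LIMSEQ_unique by auto
qed

lemma symmetric_second_derivative:
  fixes f :: "'a::real_normed_vector \<Rightarrow> 'b::real_inner"
  assumes "open S" "x \<in> S" "smooth_on S f"
  shows "frechet_derivative (\<lambda>z. frechet_derivative f (at z) v) (at x) w =
    frechet_derivative (\<lambda>z. frechet_derivative f (at z) w) (at x) v"
proof -
  have fd: "(\<lambda>z. b \<bullet> g z) differentiable (at z) \<and> frechet_derivative (\<lambda>z. b \<bullet> g z) (at z) u = b \<bullet> frechet_derivative g (at z) u"
    if "g differentiable (at z)" for b :: 'b and g :: "'a \<Rightarrow> 'b" and z u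
  proof -
    have "((\<lambda>z. b \<bullet> g z) has_derivative (\<lambda>u. b \<bullet> frechet_derivative g (at z) u)) (at z)"
      using that[unfolded frechet_derivative_works] by (auto intro!: derivative_intros)
    from differentiableI[OF this] frechet_derivative_at[OF this, symmetric]
    show ?thesis by simp
  qed
  have Ck: "Ck_on k S g \<Longrightarrow> Ck_on k S (\<lambda>z. b \<bullet> g z)" for b :: 'b and g :: "'a \<Rightarrow> 'b" and k
  proof (induction k arbitrary: g)
    case 0
    then show ?case by (auto intro!: continuous_intros)
  next
    case (Suc k)
    have "Ck_on k S (\<lambda>z. frechet_derivative (\<lambda>z. b \<bullet> g z) (at z) u)" for u
    proof (rule Ck_on_cong[OF assms(1)])
      show "Ck_on k S (\<lambda>z. b \<bullet> frechet_derivative g (at z) u)" using Suc by simp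
    qed (use Suc.prems in \<open>simp add: fd\<close>)
    then show ?case using Suc.prems fd by simp
  qed
  have *: "b \<bullet> frechet_derivative (\<lambda>z. frechet_derivative f (at z) v) (at x) w =
      frechet_derivative (\<lambda>z. frechet_derivative (\<lambda>z. b \<bullet> f z) (at z) v) (at x) w" for b v w
  proof -
    let ?g = "\<lambda>z. frechet_derivative f (at z) v"
    have d: "?g differentiable (at x)"
      using smooth_on_differentiable[OF smooth_on_frechet_derivative[OF assms(3)] assms(2)] .
    have "frechet_derivative (\<lambda>z. b \<bullet> ?g z) (at x) = frechet_derivative (\<lambda>z. frechet_derivative (\<lambda>z. b \<bullet> f z) (at z) v) (at x)"
      by (rule frechet_derivative_transform_within_open[OF _ assms(1,2)])
        (use fd d smooth_on_differentiable[OF assms(3)] in auto)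
    then show ?thesis using fd[OF d, of b w] by simp
  qed
  have "b \<bullet> frechet_derivative (\<lambda>z. frechet_derivative f (at z) v) (at x) w =
     b \<bullet> frechet_derivative (\<lambda>z. frechet_derivative f (at z) w) (at x) v" for b
    unfolding * by (rule symmetric_second_derivative_real[OF assms(1,2)])
      (use assms(3) Ck in \<open>auto simp: smooth_on_def\<close>)
  then show ?thesis using vector_eq_ldot by blast
qed

section \<open>Smooth local inverses on the line\<close>

lemma derivative_in_setI:
  assumes "f' \<in> \<A>" "\<And>t. t \<in> I \<Longrightarrow> (f has_real_derivative f' t) (at t)"
  shows "\<exists>f'\<in>\<A>. \<forall>t\<in>I. (f has_real_derivative f' t) (at t)"
  using assms by blast

text \<open>The polynomial expressions in the functions of \<open>G\<close>. If the derivatives of the generators are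
  such expressions again, then so are all derivatives, and
  \<open>smooth_on_if_closed_under_derivatives\<close> applies.\<close>

inductive_set function_algebra :: "(real \<Rightarrow> real) set \<Rightarrow> (real \<Rightarrow> real) set"
  for G :: "(real \<Rightarrow> real) set" where
  const: "(\<lambda>_. a) \<in> function_algebra G"
| gen: "f \<in> G \<Longrightarrow> f \<in> function_algebra G"
| add: "f \<in> function_algebra G \<Longrightarrow> g \<in> function_algebra G \<Longrightarrow> (\<lambda>t. f t + g t) \<in> function_algebra G"
| mult: "f \<in> function_algebra G \<Longrightarrow> g \<in> function_algebra G \<Longrightarrow> (\<lambda>t. f t * g t) \<in> function_algebra G"

lemma function_algebra_derivative:
  assumes "\<And>f. f \<in> G \<Longrightarrow> \<exists>f'\<in>function_algebra G. \<forall>t\<in>I. (f has_real_derivative f' t) (at t)"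
    and "f \<in> function_algebra G"
  shows "\<exists>f'\<in>function_algebra G. \<forall>t\<in>I. (f has_real_derivative f' t) (at t)"
  using assms(2)
proof induction
  case (const a)
  show ?case by (rule bexI[OF _ function_algebra.const[of 0]]) auto
next
  case (gen f)
  then show ?case by (rule assms(1))
next
  case (add f g)
  then obtain f' g' where D: "\<forall>t\<in>I. (f has_real_derivative f' t) (at t)"
      "\<forall>t\<in>I. (g has_real_derivative g' t) (at t)"
    and a: "f' \<in> function_algebra G" "g' \<in> function_algebra G" by blast
  show ?case
    by (rule bexI[OF _ function_algebra.add[OF a]]) (use D in \<open>auto intro: DERIV_add\<close>)
next
  case (mult f g)
  then obtain f' g' where D: "\<forall>t\<in>I. (f has_real_derivative f' t) (at t)"
      "\<forall>t\<in>I. (g has_real_derivative g' t) (at t)"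
    and a: "f' \<in> function_algebra G" "g' \<in> function_algebra G" by blast
  have "(\<lambda>t. f' t * g t + g' t * f t) \<in> function_algebra G"
    by (intro function_algebra.add function_algebra.mult a mult.hyps)
  moreover have "((\<lambda>t. f t * g t) has_real_derivative f' t * g t + g' t * f t) (at t)" if "t \<in> I" for t
    using D that by (intro DERIV_mult) auto
  ultimately show ?case by (rule derivative_in_setI)
qed

lemma function_algebra_compose:
  assumes "f \<in> function_algebra G" "\<And>f. f \<in> G \<Longrightarrow> (\<lambda>t. f (\<mu> t)) \<in> function_algebra H"
  shows "(\<lambda>t. f (\<mu> t)) \<in> function_algebra H"
  using assms(1)
  by induction (auto intro: function_algebra.intros assms(2))

lemma local_inverse_real:
  fixes g g' :: "real \<Rightarrow> real"
  assumes D: "\<And>s. (g has_real_derivative g' s) (at s)" and cont: "isCont g' 0" and neg: "g' 0 < 0"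
  obtains a b \<nu> where "a < g 0" "g 0 < b" "\<nu> (g 0) = 0"
    "\<And>y. a < y \<Longrightarrow> y < b \<Longrightarrow> g (\<nu> y) = y \<and> g' (\<nu> y) \<noteq> 0 \<and>
       (\<nu> has_real_derivative inverse (g' (\<nu> y))) (at y)"
proof -
  have "eventually (\<lambda>s. g' s < 0) (at 0)"
    using order_tendstoD(2)[OF cont[unfolded isCont_def] neg] .
  then obtain d where d: "d > 0" "\<And>s. s \<noteq> 0 \<Longrightarrow> \<bar>s\<bar> < d \<Longrightarrow> g' s < 0"
    by (auto simp: eventually_at dist_real_def)
  define r where "r = d / 2"
  have r: "r > 0" using d by (simp add: r_def)
  have g'_neg: "g' s < 0" if "\<bar>s\<bar> \<le> r" for s
    using d neg that r by (cases "s = 0") (auto simp: r_def)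
  have mono: "g s > g t" if "s < t" "-r \<le> s" "t \<le> r" for s t
    by (rule DERIV_neg_imp_decreasing[OF that(1)]) (use D g'_neg that in \<open>fastforce simp: abs_le_iff\<close>)
  have inj: "inj_on g {-r..r}"
    by (rule linorder_inj_onI) (use mono in fastforce)+
  define \<nu> where "\<nu> = inv_into {-r..r} g"
  have \<nu>g: "\<nu> (g s) = s" if "-r \<le> s" "s \<le> r" for s
    unfolding \<nu>_def using inv_into_f_f[OF inj] that by simp
  have isCont_g: "isCont g s" for s using D DERIV_isCont by blast
  have pre: "\<exists>s. -r < s \<and> s < r \<and> g s = y" if "g r < y" "y < g (-r)" for y
  proof -
    have "\<exists>s\<ge>-r. s \<le> r \<and> g s = y"
      using that r isCont_g by (intro IVT2) auto
    then obtain s where "-r \<le> s" "s \<le> r" "g s = y" by blast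
    then show ?thesis using that by (intro exI[of _ s]) (auto simp: less_le)
  qed
  have g\<nu>: "g (\<nu> y) = y" if "g r < y" "y < g (-r)" for y
    using pre[OF that] \<nu>g by force
  show thesis
  proof (rule that[of "g r" "g (-r)" \<nu>])
    show "g r < g 0" "g 0 < g (-r)" using mono r by auto
    show "\<nu> (g 0) = 0" using \<nu>g r by simp
    fix y assume y: "g r < y" "y < g (-r)"
    then obtain s where s: "-r < s" "s < r" "g s = y" using pre by blast
    have "isCont \<nu> (g s)"
      by (rule isCont_inverse_function2[of "-r" s r]) (use s \<nu>g isCont_g in auto)
    then have "isCont \<nu> y" using s by simp
    have \<nu>y: "\<nu> y = s" using s \<nu>g by auto
    have nz: "g' (\<nu> y) \<noteq> 0" using g'_neg[of s] s \<nu>y by (auto simp: abs_le_iff)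
    have "(\<nu> has_real_derivative inverse (g' (\<nu> y))) (at y)"
      by (rule DERIV_inverse_function[OF D nz y g\<nu> \<open>isCont \<nu> y\<close>])
    then show "g (\<nu> y) = y \<and> g' (\<nu> y) \<noteq> 0 \<and> (\<nu> has_real_derivative inverse (g' (\<nu> y))) (at y)"
      using nz g\<nu>[OF y] by blast
  qed
qed


section \<open>The spectral theorem for a pair of symmetric forms\<close>

text \<open>The eigenvalues of \<open>B\<close> relative to the inner product \<open>g\<close>. In the application these are the
  second and the first fundamental form on the coordinate space, where \<open>g\<close> varies with the point
  and differs from the standard inner product.\<close>

locale self_adjoint_pencil =
  fixes g B :: "'a::euclidean_space \<Rightarrow> 'a \<Rightarrow> real"
  assumes bilinear_g: "bilinear g" and bilinear_B: "bilinear B"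
    and sym_g: "g v w = g w v" and sym_B: "B v w = B w v"
    and pos_g: "v \<noteq> 0 \<Longrightarrow> g v v > 0"
begin

definition eigenspace :: "real \<Rightarrow> 'a set" where
  "eigenspace k = {v. \<forall>w. B v w = k * g v w}"

lemmas bilinear_simps =
  bilinear_ladd[OF bilinear_g] bilinear_radd[OF bilinear_g]
  bilinear_lmul[OF bilinear_g] bilinear_rmul[OF bilinear_g]
  bilinear_lzero[OF bilinear_g] bilinear_rzero[OF bilinear_g]
  bilinear_ladd[OF bilinear_B] bilinear_radd[OF bilinear_B]
  bilinear_lmul[OF bilinear_B] bilinear_rmul[OF bilinear_B]
  bilinear_lzero[OF bilinear_B] bilinear_rzero[OF bilinear_B]

lemma subspace_eigenspace: "subspace (eigenspace k)"
  by (auto simp: subspace_def eigenspace_def bilinear_simps distrib_left)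

text \<open>Let \<open>k\<close> be the minimum of \<open>B v v / g v v\<close> on \<open>W\<close>. The form \<open>Q = B - k g\<close> is nonnegative on
  \<open>W\<close> and vanishes on a minimizer \<open>v\<close>, so the first variation \<open>Q v w\<close> vanishes as well.\<close>

lemma rayleigh_minimizer:
  assumes "subspace W" "W \<noteq> {0}"
  obtains v k where "v \<in> W" "v \<noteq> 0" "\<And>w. w \<in> W \<Longrightarrow> B v w = k * g v w"
proof -
  let ?S = "W \<inter> sphere 0 1"
  let ?q = "\<lambda>v. B v v / g v v"
  have normalize: "(1 / norm w) *\<^sub>R w \<in> ?S" if "w \<in> W" "w \<noteq> 0" for w
    using that assms(1) by (auto simp: subspace_scale)
  obtain w0 where "w0 \<in> W" "w0 \<noteq> 0" using assms subspace_0 by blast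
  then have ne: "?S \<noteq> {}" using normalize by blast
  have "compact ?S" using closed_subspace[OF assms(1)] by (simp add: closed_Int_compact)
  moreover have "continuous_on ?S ?q"
  proof -
    have "continuous_on ?S (\<lambda>v. h v v)" if "bilinear h" for h :: "'a \<Rightarrow> 'a \<Rightarrow> real"
      by (rule bounded_bilinear.continuous_on[OF that[unfolded bilinear_conv_bounded_bilinear]
        continuous_on_id continuous_on_id])
    moreover have "g v v \<noteq> 0" if "v \<in> ?S" for v
    proof -
      have "v \<noteq> 0" using that by auto
      then show ?thesis using pos_g[of v] by simp
    qed
    ultimately show ?thesis using bilinear_g bilinear_B by (intro continuous_on_divide) auto
  qed
  ultimately obtain v where v: "v \<in> ?S" and min: "\<And>w. w \<in> ?S \<Longrightarrow> ?q v \<le> ?q w"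
    using continuous_attains_inf[OF _ ne, of ?q] by blast
  define k where "k = ?q v"
  define Q where "Q = (\<lambda>v w. B v w - k * g v w)"
  have v0: "v \<noteq> 0" using v by auto
  have Qv: "Q v v = 0" using pos_g[OF v0] by (simp add: Q_def k_def)
  have Q0: "Q w w \<ge> 0" if "w \<in> W" for w
  proof (cases "w = 0")
    case False
    have "k \<le> ?q ((1 / norm w) *\<^sub>R w)" using min[OF normalize[OF that False]] by (simp add: k_def)
    also have "\<dots> = ?q w" using False by (simp add: bilinear_simps)
    finally show ?thesis using pos_g[OF False] by (simp add: Q_def pos_le_divide_eq)
  qed (simp add: Q_def bilinear_simps)
  have "B v w = k * g v w" if w: "w \<in> W" for w
  proof -
    define a b where "a = Q v w" and "b = Q w w"
    have b: "b \<ge> 0" using Q0 w b_def by simp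
    have expand: "2 * s * a + s\<^sup>2 * b \<ge> 0" for s
    proof -
      have "Q (v + s *\<^sub>R w) (v + s *\<^sub>R w) \<ge> 0"
        using v w assms(1) by (intro Q0) (auto simp: subspace_add subspace_scale)
      moreover have "Q (v + s *\<^sub>R w) (v + s *\<^sub>R w) = Q v v + 2 * s * a + s\<^sup>2 * b"
        using sym_g[of w v] sym_B[of w v]
        by (simp add: Q_def a_def b_def bilinear_simps algebra_simps power2_eq_square)
      ultimately show ?thesis using Qv by simp
    qed
    \<comment> \<open>At \<open>s = - a / b\<close> the parabola is minimal; with the denominator \<open>b + 1\<close> its value is still
      negative unless \<open>a = 0\<close>, and \<open>b = 0\<close> is not exceptional.\<close>
    have "2 * (- a / (b + 1)) * a + (- a / (b + 1))\<^sup>2 * b = - (a\<^sup>2 * (b + 2) / (b + 1)\<^sup>2)"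
      using b by (simp add: divide_simps power2_eq_square) (simp add: algebra_simps)
    then have "a\<^sup>2 * (b + 2) / (b + 1)\<^sup>2 \<le> 0" using expand[of "- a / (b + 1)"] by linarith
    then have "a\<^sup>2 * (b + 2) \<le> 0" using b by (simp add: divide_le_0_iff)
    then have "a = 0" using b by (simp add: mult_le_0_iff)
    then show ?thesis by (simp add: a_def Q_def)
  qed
  then show thesis using that v v0 by blast
qed

definition complement :: "'a set \<Rightarrow> 'a set" where
  "complement W = {v. \<forall>w\<in>W. g v w = 0}"

lemma subspace_complement: "subspace (complement W)"
  by (auto simp: subspace_def complement_def bilinear_simps)

lemma complement_disjoint: "0 \<in> W \<Longrightarrow> W \<inter> complement W = {0}"
  using pos_g by (force simp: complement_def bilinear_simps)

text \<open>The linear map \<open>G\<close> that represents \<open>g\<close> through the standard inner product is bijective and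
  carries the \<open>g\<close>-complement onto the ordinary orthogonal complement.\<close>

lemma dim_complement:
  assumes "subspace W"
  shows "dim W + dim (complement W) = DIM('a)"
proof -
  \<comment> \<open>The Riesz representation of \<open>g v\<close>.\<close>
  define G where "G = (\<lambda>v. \<Sum>b\<in>Basis. g v b *\<^sub>R b)"
  have G: "G v \<bullet> w = g v w" for v w
  proof -
    interpret l: linear "g v" using bilinear_g by (simp add: bilinear_def)
    have "g v w = g v (\<Sum>b\<in>Basis. (w \<bullet> b) *\<^sub>R b)" by (simp add: euclidean_representation)
    also have "\<dots> = G v \<bullet> w"
      unfolding G_def inner_sum_left l.sum l.scale
      by (intro sum.cong refl) (simp add: inner_commute mult.commute)
    finally show ?thesis by simp
  qed
  have lin: "linear G"
    by (rule linearI) (simp_all add: G_def bilinear_simps scaleR_add_left sum.distrib scaleR_sum_right)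
  have "G v \<noteq> 0" if "v \<noteq> 0" for v using G[of v v] pos_g[OF that] by auto
  then have inj: "inj G" using linear_injective_0[OF lin] by blast
  have "surj G" using inj linear_injective_imp_surjective[OF lin] by blast
  have "G ` complement W = {y \<in> UNIV. \<forall>x\<in>W. orthogonal x y}"
  proof
    show "G ` complement W \<subseteq> {y \<in> UNIV. \<forall>x\<in>W. orthogonal x y}"
      by (auto simp: complement_def orthogonal_def G inner_commute[of _ "G _"])
    show "{y \<in> UNIV. \<forall>x\<in>W. orthogonal x y} \<subseteq> G ` complement W"
    proof
      fix y assume y: "y \<in> {y \<in> UNIV. \<forall>x\<in>W. orthogonal x y}"
      obtain v where v: "y = G v" using \<open>surj G\<close> by blast
      then have "v \<in> complement W"
        using y by (auto simp: complement_def orthogonal_def G[symmetric] inner_commute[of "G _"])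
      then show "y \<in> G ` complement W" using v by blast
    qed
  qed
  then have "dim (complement W) = dim {y \<in> UNIV. \<forall>x\<in>W. orthogonal x y}"
    using dim_image_eq[OF lin inj_on_subset[OF inj subset_UNIV]] by metis
  then show ?thesis
    using dim_subspace_orthogonal_to_vectors[OF assms subspace_UNIV] by simp
qed

lemma complement_sum:
  assumes "subspace W"
  obtains a b where "a \<in> W" "b \<in> complement W" "v = a + b"
proof -
  let ?S = "{x + y |x y. x \<in> W \<and> y \<in> complement W}"
  have "dim ?S = DIM('a)"
    using dim_sums_Int[OF assms subspace_complement[of W]] dim_complement[OF assms]
      complement_disjoint[OF subspace_0[OF assms]] by simp
  then have "?S = UNIV"
    using subspace_dim_equal[of ?S UNIV] subspace_sums[OF assms subspace_complement[of W]] by simp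
  then show thesis using that by blast
qed

text \<open>Otherwise the \<open>g\<close>-complement of the span is nonzero and contains a minimizer of the Rayleigh
  quotient. On the span both forms vanish against it, so it is an eigenvector on the whole space,
  which lies outside the span of the eigenvectors.\<close>

lemma eigenvectors_span: "span (\<Union>k. eigenspace k) = UNIV"
proof (rule ccontr)
  let ?W = "span (\<Union>k. eigenspace k)"
  assume "?W \<noteq> UNIV"
  have sub: "subspace ?W" by simp
  have "complement ?W \<noteq> {0}"
  proof
    assume c: "complement ?W = {0}"
    have "v \<in> ?W" for v using complement_sum[OF sub, of v] c by auto
    then show False using \<open>?W \<noteq> UNIV\<close> by blast
  qed
  then obtain v k where v: "v \<in> complement ?W" "v \<noteq> 0"
    and k: "\<And>w. w \<in> complement ?W \<Longrightarrow> B v w = k * g v w"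
    using rayleigh_minimizer[OF subspace_complement] by metis
  have gW: "g v w = 0" if "w \<in> ?W" for w using v(1) that by (simp add: complement_def)
  have BW: "B v w = 0" if "w \<in> ?W" for w
    using that
  proof (induction rule: span_induct)
    case base
    then show ?case by (auto simp: subspace_def bilinear_simps)
  next
    case (step w)
    then obtain l where "w \<in> eigenspace l" by blast
    then have "B w v = l * g w v" by (simp add: eigenspace_def)
    moreover have "g v w = 0" using step by (intro gW span_base)
    ultimately show ?case using sym_B[of v w] sym_g[of v w] by simp
  qed
  have "v \<in> eigenspace k"
    unfolding eigenspace_def
  proof safe
    fix w
    obtain a b where "a \<in> ?W" "b \<in> complement ?W" "w = a + b" using complement_sum[OF sub] by blast
    then show "B v w = k * g v w" by (simp add: bilinear_simps gW BW k)
  qed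
  then have "v \<in> ?W" by (intro span_base) blast
  then show False using gW v(2) pos_g by fastforce
qed

text \<open>Eigenspaces for distinct eigenvalues are \<open>g\<close>-orthogonal, hence independent.\<close>

lemma dim_span_eigenspaces:
  assumes "finite K"
  shows "dim (span (\<Union>k\<in>K. eigenspace k)) = (\<Sum>k\<in>K. dim (eigenspace k))"
  using assms
proof (induction K rule: finite_induct)
  case (insert l K)
  let ?T = "span (\<Union>k\<in>K. eigenspace k)"
  have "x = 0" if x: "x \<in> eigenspace l" "x \<in> ?T" for x
  proof -
    have "g x y = 0" if "y \<in> ?T" for y
      using that
    proof (induction rule: span_induct)
      case base
      then show ?case by (auto simp: subspace_def bilinear_simps)
    next
      case (step y)
      then obtain k where k: "k \<in> K" "y \<in> eigenspace k" by blast
      then have "l * g x y = k * g x y"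
        using x(1) sym_B[of x y] sym_g[of x y] by (simp add: eigenspace_def)
      moreover have "k \<noteq> l" using k insert.hyps by blast
      ultimately show ?case by simp
    qed
    then show ?thesis using x(2) pos_g by fastforce
  qed
  then have disj: "eigenspace l \<inter> ?T = {0}" using subspace_0[OF subspace_eigenspace] span_0 by blast
  have "span (\<Union>k\<in>insert l K. eigenspace k) = {x + y |x y. x \<in> eigenspace l \<and> y \<in> ?T}"
    by (simp add: span_Un span_eq_iff[THEN iffD2, OF subspace_eigenspace])
  moreover have "dim {x + y |x y. x \<in> eigenspace l \<and> y \<in> ?T} = dim (eigenspace l) + dim ?T"
    using dim_sums_Int[OF subspace_eigenspace[of l] subspace_span, of "\<Union>k\<in>K. eigenspace k"] disj by simp
  ultimately show ?case using insert by simp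
qed simp

text \<open>Every eigenvalue contributes at least \<open>1\<close> to the dimension of the span of the eigenspaces, which
  bounds their number.\<close>

theorem eigenvalues_finite_and_complete:
  shows "finite {k. eigenspace k \<noteq> {0}}"
    and "(\<Sum>k | eigenspace k \<noteq> {0}. dim (eigenspace k)) = DIM('a)"
proof -
  let ?K = "{k. eigenspace k \<noteq> {0}}"
  have "finite ?K \<and> card ?K \<le> DIM('a)"
  proof (rule finite_if_finite_subsets_card_bdd)
    fix K assume K: "K \<subseteq> ?K" "finite K"
    have "1 \<le> dim (eigenspace k)" if "k \<in> K" for k
    proof -
      have "\<not> eigenspace k \<subseteq> {0}"
        using K that subspace_0[OF subspace_eigenspace[of k]] by blast
      then show ?thesis by (simp add: Suc_le_eq del: dim_eq_0 flip: dim_eq_0)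
    qed
    then have "card K \<le> (\<Sum>k\<in>K. dim (eigenspace k))"
      using sum_mono[of K "\<lambda>_. 1" "\<lambda>k. dim (eigenspace k)"] by simp
    also have "\<dots> \<le> DIM('a)"
      unfolding dim_span_eigenspaces[OF K(2), symmetric] by (rule dim_subset_UNIV)
    finally show "card K \<le> DIM('a)" .
  qed
  then show fin: "finite ?K" ..
  have "(\<Union>k. eigenspace k) \<subseteq> span (\<Union>k\<in>?K. eigenspace k)"
  proof
    fix v assume "v \<in> (\<Union>k. eigenspace k)"
    then obtain k where k: "v \<in> eigenspace k" by blast
    show "v \<in> span (\<Union>k\<in>?K. eigenspace k)"
    proof (cases "eigenspace k = {0}")
      case True
      then show ?thesis using k span_0 by auto
    qed (use k in \<open>blast intro: span_base\<close>)
  qed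
  then have "span (\<Union>k\<in>?K. eigenspace k) = UNIV"
    using eigenvectors_span span_minimal[OF _ subspace_span] by blast
  then show "(\<Sum>k\<in>?K. dim (eigenspace k)) = DIM('a)"
    using dim_span_eigenspaces[OF fin] by simp
qed

end

lemma eigenvalue_multiset:
  fixes K :: "real set"
  assumes "finite K"
  shows "size (\<Sum>k\<in>K. replicate_mset (d k) k) = (\<Sum>k\<in>K. d k)"
    and "set_mset (\<Sum>k\<in>K. replicate_mset (d k) k) = {k \<in> K. d k > 0}"
    and "image_mset f (\<Sum>k\<in>K. replicate_mset (d k) k) = (\<Sum>k\<in>K. replicate_mset (d k) (f k))"
  using assms
proof (induction K rule: finite_induct)
  case (insert k K)
  {
    case 1 show ?case using insert by simp
  next
    case 2
    have "set_mset (replicate_mset (d k) k) = {l \<in> {k}. d l > 0}" by auto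
    then show ?case using insert by auto
  next
    case 3 show ?case using insert by simp
  }
qed simp_all

text \<open>The transformation of principal curvatures when the shape operator is replaced by a function \<open>f\<close>
  of itself: the eigenspaces stay and the eigenvalues move by \<open>f\<close>. It serves both for parallel
  hypersurfaces and for a change of orientation.\<close>

lemma eigenvalue_multiset_reparametrize:
  fixes E E' :: "real \<Rightarrow> 'a::euclidean_space set"
  assumes fin: "finite {k. E k \<noteq> {0}}"
    and E': "\<And>k. E k \<noteq> {0} \<Longrightarrow> E' (f k) = E k"
    and surj: "\<And>l. E' l \<noteq> {0} \<Longrightarrow> \<exists>k. E k \<noteq> {0} \<and> f k = l"
    and inj: "inj_on f {k. E k \<noteq> {0}}"
  shows "(\<Sum>l | E' l \<noteq> {0}. replicate_mset (dim (E' l)) l) =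
    image_mset f (\<Sum>k | E k \<noteq> {0}. replicate_mset (dim (E k)) k)"
proof -
  have "{l. E' l \<noteq> {0}} = f ` {k. E k \<noteq> {0}}"
  proof
    show "{l. E' l \<noteq> {0}} \<subseteq> f ` {k. E k \<noteq> {0}}" using surj by blast
    show "f ` {k. E k \<noteq> {0}} \<subseteq> {l. E' l \<noteq> {0}}" 
    proof
      fix l assume "l \<in> f ` {k. E k \<noteq> {0}}"
      then obtain k where k: "l = f k" "E k \<noteq> {0}" by blast
      show "l \<in> {l. E' l \<noteq> {0}}" using k(2) unfolding k(1) mem_Collect_eq E'[OF k(2)] .
    qed
  qed
  then have "(\<Sum>l | E' l \<noteq> {0}. replicate_mset (dim (E' l)) l) =
    (\<Sum>k | E k \<noteq> {0}. replicate_mset (dim (E' (f k))) (f k))"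
    using sum.reindex[OF inj] by simp
  also have "\<dots> = (\<Sum>k | E k \<noteq> {0}. replicate_mset (dim (E k)) (f k))"
  proof (rule sum.cong[OF refl])
    fix k assume "k \<in> {k. E k \<noteq> {0}}"
    then have "E' (f k) = E k" by (intro E') simp
    then show "replicate_mset (dim (E' (f k))) (f k) = replicate_mset (dim (E k)) (f k)" by (rule arg_cong)
  qed
  finally show ?thesis by (simp add: eigenvalue_multiset(3)[OF fin])
qed

section \<open>The geometry of the space forms\<close>

lemma C_eps_0 [simp]: "C_eps \<epsilon> 0 = 1" and S_eps_0 [simp]: "S_eps \<epsilon> 0 = 0"
  by (simp_all add: C_eps_def S_eps_def)

lemma C_S_eps_identity:
  "\<epsilon> \<in> {-1, 0, 1} \<Longrightarrow> (C_eps \<epsilon> m)\<^sup>2 + \<epsilon> * (S_eps \<epsilon> m)\<^sup>2 = 1"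
  by (auto simp: C_eps_def S_eps_def cosh_square_eq)

lemma DERIV_C_eps:
  "\<epsilon> \<in> {-1, 0, 1} \<Longrightarrow> (C_eps \<epsilon> has_real_derivative - (\<epsilon> * S_eps \<epsilon> m)) (at m)"
  unfolding C_eps_def[abs_def] S_eps_def[abs_def]
  by (auto intro!: derivative_eq_intros)

lemma DERIV_S_eps:
  "\<epsilon> \<in> {-1, 0, 1} \<Longrightarrow> (S_eps \<epsilon> has_real_derivative C_eps \<epsilon> m) (at m)"
  unfolding C_eps_def[abs_def] S_eps_def[abs_def]
  by (auto intro!: derivative_eq_intros)

lemma ambient_form_inner:
  "ambient_form \<epsilon> p v w = (v - (if \<epsilon> = -1 then 2 * v $ p else 0) *\<^sub>R axis p 1) \<bullet> w"
proof -
  have "v \<bullet> w = v $ p * w $ p + (\<Sum>i\<in>UNIV - {p}. v $ i * w $ i)"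
    by (simp add: inner_vec_def sum.remove[of UNIV p])
  moreover have "axis p 1 \<bullet> w = w $ p" by (simp add: inner_axis')
  ultimately show ?thesis by (simp add: ambient_form_def inner_diff_left)
qed

lemma bilinear_ambient_form: "bilinear (ambient_form \<epsilon> p)"
  unfolding bilinear_def
  by (auto simp: ambient_form_inner inner_diff_left algebra_simps intro!: linearI)

lemma ambient_form_commute: "ambient_form \<epsilon> p v w = ambient_form \<epsilon> p w v"
  by (simp add: ambient_form_def inner_commute mult.commute)

lemmas ambient_form_simps =
  bilinear_ladd[OF bilinear_ambient_form] bilinear_radd[OF bilinear_ambient_form]
  bilinear_lmul[OF bilinear_ambient_form] bilinear_rmul[OF bilinear_ambient_form]
  bilinear_lneg[OF bilinear_ambient_form] bilinear_rneg[OF bilinear_ambient_form]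
  bilinear_lsub[OF bilinear_ambient_form] bilinear_rsub[OF bilinear_ambient_form]
  bilinear_lzero[OF bilinear_ambient_form] bilinear_rzero[OF bilinear_ambient_form]

lemma ambient_form_nondegenerate:
  assumes "\<And>w. ambient_form \<epsilon> p z w = 0"
  shows "z = 0"
proof -
  let ?z = "z - (if \<epsilon> = -1 then 2 * z $ p else 0) *\<^sub>R axis p 1"
  have "?z \<bullet> ?z = 0" using assms ambient_form_inner by metis
  then have z: "?z = 0" by simp
  then have "?z $ p = 0" by (simp del: vector_minus_component)
  then have "z $ p = 0" by (simp split: if_splits)
  then have "?z = z" by simp
  then show ?thesis using z by metis
qed

lemma ambient_form_space_form:
  assumes "\<epsilon> \<in> {-1, 0, 1}" "\<epsilon> \<noteq> 0" "x \<in> space_form \<epsilon> p"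
  shows "ambient_form \<epsilon> p x x = \<epsilon>"
  using assms by (auto simp: space_form_def ambient_form_def dot_square_norm)

text \<open>The Cauchy-Schwarz inequality in the spacelike coordinates, in which the two hypotheses replace
  the scalar product of \<open>z\<close> and \<open>x\<close> and the square norm of \<open>x\<close> by expressions in the timelike
  coordinates.\<close>

lemma lorentz_cauchy_schwarz:
  assumes "x \<in> space_form (-1) p" "ambient_form (-1) p z x = 0"
  shows "(z $ p)\<^sup>2 * (x $ p)\<^sup>2 \<le> (\<Sum>i\<in>UNIV - {p}. (z $ i)\<^sup>2) * ((x $ p)\<^sup>2 - 1)"
proof -
  have "(\<Sum>i\<in>UNIV - {p}. z $ i * x $ i) = z $ p * x $ p"
    and "(\<Sum>i\<in>UNIV - {p}. (x $ i)\<^sup>2) = (x $ p)\<^sup>2 - 1"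
    using assms by (auto simp: space_form_def ambient_form_def power2_eq_square)
  then show ?thesis
    using Cauchy_Schwarz_ineq_sum[of "\<lambda>i. z $ i" "\<lambda>i. x $ i" "UNIV - {p}"]
    by (simp add: power_mult_distrib)
qed

text \<open>For \<open>\<epsilon> = -1\<close> the ambient form is indefinite, but a vector orthogonal to the timelike position
  vector is spacelike. So the first fundamental form is positive definite in all three cases.\<close>

lemma ambient_form_positive_on_tangent_space:
  assumes "\<epsilon> \<in> {-1, 0, 1}" "x \<in> space_form \<epsilon> p"
    and "\<epsilon> \<noteq> 0 \<Longrightarrow> ambient_form \<epsilon> p z x = 0" "z \<noteq> 0"
  shows "ambient_form \<epsilon> p z z > 0"
proof (cases "\<epsilon> = -1")
  case True
  define Z where "Z = (\<Sum>i\<in>UNIV - {p}. (z $ i)\<^sup>2)"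
  have Z: "Z \<ge> 0" by (simp add: Z_def sum_nonneg)
  have cs: "(z $ p)\<^sup>2 * (x $ p)\<^sup>2 \<le> Z * ((x $ p)\<^sup>2 - 1)"
    using lorentz_cauchy_schwarz assms True by (simp add: Z_def)
  have xp: "x $ p > 0" using assms True by (simp add: space_form_def)
  have "Z \<noteq> 0"
  proof
    assume "Z = 0"
    then have "z $ p = 0" using cs xp by (simp add: mult_le_0_iff)
    moreover have "z $ i = 0" if "i \<noteq> p" for i
      using \<open>Z = 0\<close> that by (simp add: Z_def sum_nonneg_eq_0_iff)
    ultimately have "z = 0" by (metis vec_eq_iff zero_index)
    then show False using assms by blast
  qed
  then have "0 < (Z - (z $ p)\<^sup>2) * (x $ p)\<^sup>2" using cs Z by (simp add: algebra_simps)
  then have "Z - (z $ p)\<^sup>2 > 0" using xp by (simp add: zero_less_mult_iff)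
  then show ?thesis using True by (simp add: ambient_form_def Z_def power2_eq_square)
qed (use assms in \<open>simp add: ambient_form_def\<close>)

text \<open>The point in question lies on the geodesic from \<open>x\<close> with unit velocity \<open>z\<close>. In hyperbolic space
  it stays on the upper sheet because the timelike coordinates satisfy \<open>\<bar>z\<^sub>p\<bar> < x\<^sub>p\<close>, and
  \<open>\<bar>sinh m\<bar> < cosh m\<close>.\<close>

lemma space_form_geodesic:
  assumes "\<epsilon> \<in> {-1, 0, 1}" "x \<in> space_form \<epsilon> p"
    and "\<epsilon> \<noteq> 0 \<Longrightarrow> ambient_form \<epsilon> p z x = 0" "ambient_form \<epsilon> p z z = 1"
  shows "C_eps \<epsilon> m *\<^sub>R x + S_eps \<epsilon> m *\<^sub>R z \<in> space_form \<epsilon> p"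
proof (cases "\<epsilon> = 0")
  case False
  let ?y = "C_eps \<epsilon> m *\<^sub>R x + S_eps \<epsilon> m *\<^sub>R z"
  have "ambient_form \<epsilon> p ?y ?y = (C_eps \<epsilon> m)\<^sup>2 * \<epsilon> + (S_eps \<epsilon> m)\<^sup>2"
    using assms(3)[OF False] assms(4) ambient_form_space_form[OF assms(1) False assms(2)]
      ambient_form_commute[of \<epsilon> p x z]
    by (simp add: ambient_form_simps power2_eq_square)
  also have "\<dots> = \<epsilon>"
  proof -
    have "\<epsilon> * \<epsilon> = 1" using assms(1) False by auto
    then have "(C_eps \<epsilon> m)\<^sup>2 * \<epsilon> + (S_eps \<epsilon> m)\<^sup>2 = \<epsilon> * ((C_eps \<epsilon> m)\<^sup>2 + \<epsilon> * (S_eps \<epsilon> m)\<^sup>2)"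
      by (simp add: distrib_left mult.assoc[symmetric] mult.commute)
    then show ?thesis using C_S_eps_identity[OF assms(1)] by simp
  qed
  finally have form: "ambient_form \<epsilon> p ?y ?y = \<epsilon>" .
  show ?thesis
  proof (cases "\<epsilon> = 1")
    case True
    then have "norm ?y = 1" using form by (simp add: ambient_form_def norm_eq_1 del: real_norm_def)
    then show ?thesis using True by (simp add: space_form_def)
  next
    case False
    then have e: "\<epsilon> = -1" using assms(1) \<open>\<epsilon> \<noteq> 0\<close> by auto
    have xp: "x $ p > 0" using assms e by (simp add: space_form_def)
    have "(\<Sum>i\<in>UNIV - {p}. (z $ i)\<^sup>2) = 1 + (z $ p)\<^sup>2"
      using assms(4) e by (simp add: ambient_form_def power2_eq_square)
    then have "(z $ p)\<^sup>2 * (x $ p)\<^sup>2 \<le> (1 + (z $ p)\<^sup>2) * ((x $ p)\<^sup>2 - 1)"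
      using lorentz_cauchy_schwarz[of x p z] assms e by simp
    then have "(z $ p)\<^sup>2 < (x $ p)\<^sup>2" by (simp add: algebra_simps)
    then have zp: "\<bar>z $ p\<bar> < x $ p" using xp abs_square_less_1 power2_less_imp_less[of "\<bar>z $ p\<bar>" "x $ p"] by simp
    have "\<bar>sinh m * z $ p\<bar> \<le> cosh m * \<bar>z $ p\<bar>"
    proof -
      have "\<bar>sinh m\<bar> \<le> cosh m" using sinh_less_cosh_real[of m] sinh_less_cosh_real[of "-m"] by simp
      then show ?thesis by (simp add: abs_mult mult_right_mono)
    qed
    also have "\<dots> < cosh m * x $ p" using zp by simp
    finally have "?y $ p > 0" using e by (simp add: C_eps_def S_eps_def)
    then show ?thesis using form e by (simp add: space_form_def)
  qed
qed (use assms in \<open>simp add: space_form_def\<close>)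


section \<open>The Jacobian of the parallel maps\<close>

lemma DERIV_prod_mset:
  fixes f :: "'a \<Rightarrow> real \<Rightarrow> real"
  assumes "\<And>k. k \<in># M \<Longrightarrow> (f k has_real_derivative f' k) (at t)"
    and "\<And>k. k \<in># M \<Longrightarrow> f k t \<noteq> 0"
  shows "((\<lambda>t. \<Prod>k\<in>#M. f k t) has_real_derivative
    (\<Prod>k\<in>#M. f k t) * (\<Sum>k\<in>#M. f' k / f k t)) (at t)"
  using assms
proof (induction M)
  case (add k M)
  have "((\<lambda>t. f k t * (\<Prod>k\<in>#M. f k t)) has_real_derivative
    f' k * (\<Prod>k\<in>#M. f k t) + (\<Prod>k\<in>#M. f k t) * (\<Sum>k\<in>#M. f' k / f k t) * f k t) (at t)"
    using add by (intro DERIV_mult add.IH) auto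
  moreover have "f' k * X + X * Y * f k t = (f k t * X) * (f' k / f k t + Y)" for X Y
    using add.prems(2)[of k] by (simp add: field_simps)
  ultimately show ?case by simp
qed simp

text \<open>The determinant of \<open>C - S A\<close> for a shape operator \<open>A\<close> with eigenvalues \<open>M\<close>, which is the signed
  factor by which the parallel map at distance \<open>m\<close> changes the volume element.\<close>

definition parallel_jacobian :: "real \<Rightarrow> real multiset \<Rightarrow> real \<Rightarrow> real" where
  "parallel_jacobian \<epsilon> M m = (\<Prod>k\<in>#M. C_eps \<epsilon> m - k * S_eps \<epsilon> m)"

lemma parallel_jacobian_0: "parallel_jacobian \<epsilon> M 0 = 1"
  by (simp add: parallel_jacobian_def)

text \<open>The sum in the logarithmic derivative is the mean curvature of the parallel hypersurface: the
  first variation of volume is governed by mean curvature.\<close>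

lemma DERIV_parallel_jacobian:
  assumes "\<epsilon> \<in> {-1, 0, 1}" "\<And>k. k \<in># M \<Longrightarrow> C_eps \<epsilon> m - k * S_eps \<epsilon> m \<noteq> 0"
  shows "(parallel_jacobian \<epsilon> M has_real_derivative
    - (parallel_jacobian \<epsilon> M m *
       (\<Sum>k\<in>#M. (k * C_eps \<epsilon> m + \<epsilon> * S_eps \<epsilon> m) / (C_eps \<epsilon> m - k * S_eps \<epsilon> m)))) (at m)"
proof -
  have "((\<lambda>m. \<Prod>k\<in>#M. C_eps \<epsilon> m - k * S_eps \<epsilon> m) has_real_derivative
      (\<Prod>k\<in>#M. C_eps \<epsilon> m - k * S_eps \<epsilon> m) *
      (\<Sum>k\<in>#M. - (k * C_eps \<epsilon> m + \<epsilon> * S_eps \<epsilon> m) / (C_eps \<epsilon> m - k * S_eps \<epsilon> m))) (at m)"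
    by (rule DERIV_prod_mset)
      (use assms in \<open>auto intro!: derivative_eq_intros DERIV_C_eps DERIV_S_eps\<close>)
  moreover have "(\<Sum>k\<in>#M. - (k * C_eps \<epsilon> m + \<epsilon> * S_eps \<epsilon> m) / (C_eps \<epsilon> m - k * S_eps \<epsilon> m)) =
     - (\<Sum>k\<in>#M. (k * C_eps \<epsilon> m + \<epsilon> * S_eps \<epsilon> m) / (C_eps \<epsilon> m - k * S_eps \<epsilon> m))"
    by (induction M) (auto simp: minus_divide_left)
  ultimately show ?thesis by (simp add: parallel_jacobian_def[abs_def])
qed

lemma parallel_jacobian_in_algebra:
  "parallel_jacobian \<epsilon> M \<in> function_algebra {C_eps \<epsilon>, S_eps \<epsilon>}"
proof (induction M)
  case empty
  then show ?case by (simp add: parallel_jacobian_def[abs_def] function_algebra.const)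
next
  case (add k M)
  have "(\<lambda>m. (C_eps \<epsilon> m + (- k) * S_eps \<epsilon> m) * parallel_jacobian \<epsilon> M m) \<in> function_algebra {C_eps \<epsilon>, S_eps \<epsilon>}"
    by (intro function_algebra.mult function_algebra.add function_algebra.const add)
      (auto intro: function_algebra.gen)
  then show ?case by (simp add: parallel_jacobian_def[abs_def])
qed

text \<open>The Jacobian \<open>g\<close> equals \<open>1\<close> at \<open>0\<close> and has derivative minus the sum of the curvatures there,
  which is not zero; \<open>\<mu>(t)\<close> is its local inverse at \<open>e\<^sup>t\<close>. It satisfies \<open>\<mu>' = g(\<mu>) / g'(\<mu>)\<close>, where
  \<open>g\<close> is a polynomial in \<open>C\<close> and \<open>S\<close>. Hence the polynomials in \<open>\<mu>\<close>, \<open>C(\<mu>)\<close>, \<open>S(\<mu>)\<close> and \<open>1 / g'(\<mu>)\<close>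
  are closed under differentiation, which makes \<open>\<mu>\<close> smooth.\<close>

lemma parallel_jacobian_parametrization:
  assumes eps: "\<epsilon> \<in> {-1, 0, 1}" and pos: "(\<Sum>k\<in>#M. k) > 0"
  obtains I \<mu> where "open_interval_around_0 I" "smooth_on I \<mu>" "\<mu> 0 = 0"
    "\<And>t. t \<in> I \<Longrightarrow> parallel_jacobian \<epsilon> M (\<mu> t) = exp t"
proof -
  let ?T = "{C_eps \<epsilon>, S_eps \<epsilon>}"
  let ?g = "parallel_jacobian \<epsilon> M"
  have deriv: "\<exists>f'\<in>function_algebra ?T. \<forall>t\<in>UNIV. (f has_real_derivative f' t) (at t)"
    if "f \<in> function_algebra ?T" for f
  proof (rule function_algebra_derivative[OF _ that])
    fix f assume "f \<in> ?T"
    moreover have "\<exists>f'\<in>function_algebra ?T. \<forall>t\<in>UNIV. (C_eps \<epsilon> has_real_derivative f' t) (at t)"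
    proof (rule derivative_in_setI)
      show "(\<lambda>m. (- \<epsilon>) * S_eps \<epsilon> m) \<in> function_algebra ?T"
        by (intro function_algebra.mult function_algebra.const function_algebra.gen) simp
    qed (use DERIV_C_eps[OF eps] in simp)
    moreover have "\<exists>f'\<in>function_algebra ?T. \<forall>t\<in>UNIV. (S_eps \<epsilon> has_real_derivative f' t) (at t)"
      by (rule derivative_in_setI[of "C_eps \<epsilon>"]) (use DERIV_S_eps[OF eps] in \<open>auto intro: function_algebra.gen\<close>)
    ultimately show "\<exists>f'\<in>function_algebra ?T. \<forall>t\<in>UNIV. (f has_real_derivative f' t) (at t)" by blast
  qed
  obtain g' where g': "g' \<in> function_algebra ?T" "\<And>s. (?g has_real_derivative g' s) (at s)"
    using deriv[OF parallel_jacobian_in_algebra] by blast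
  obtain g'' where g'': "g'' \<in> function_algebra ?T" "\<And>s. (g' has_real_derivative g'' s) (at s)"
    using deriv[OF g'(1)] by blast
  have "g' 0 = - (\<Sum>k\<in>#M. k)"
    using DERIV_unique[OF g'(2)[of 0] DERIV_parallel_jacobian[OF eps, of M 0]]
    by (simp add: parallel_jacobian_0)
  then have "g' 0 < 0" using pos by simp
  then obtain a b \<nu> where ab: "a < 1" "1 < b" "\<nu> 1 = 0"
    and \<nu>: "\<And>y. a < y \<Longrightarrow> y < b \<Longrightarrow> ?g (\<nu> y) = y \<and> g' (\<nu> y) \<noteq> 0 \<and>
       (\<nu> has_real_derivative inverse (g' (\<nu> y))) (at y)"
    using local_inverse_real[OF g'(2) DERIV_isCont[OF g''(2)]] by (metis parallel_jacobian_0)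
  define I where "I = {t. a < exp t \<and> exp t < b}"
  define \<mu> where "\<mu> = (\<lambda>t. \<nu> (exp t))"
  have "open I" unfolding I_def by (intro open_Collect_conj open_Collect_less continuous_intros)
  moreover have "is_interval I"
    unfolding is_interval_1 I_def by (auto intro: less_le_trans[OF _ exp_le_cancel_iff[THEN iffD2]]
        le_less_trans[OF exp_le_cancel_iff[THEN iffD2]])
  moreover have "0 \<in> I" using ab by (simp add: I_def)
  ultimately have I: "open_interval_around_0 I" by (simp add: open_interval_around_0_def)
  have g\<mu>: "?g (\<mu> t) = exp t" and nz: "g' (\<mu> t) \<noteq> 0" if "t \<in> I" for t
    using \<nu>[of "exp t"] that by (auto simp: I_def \<mu>_def)
  have D\<mu>: "(\<mu> has_real_derivative ?g (\<mu> t) * (1 / g' (\<mu> t))) (at t)" if "t \<in> I" for t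
  proof -
    have "(\<nu> has_real_derivative inverse (g' (\<mu> t))) (at (exp t))"
      using \<nu>[of "exp t"] that by (simp add: I_def \<mu>_def)
    from DERIV_chain2[OF this DERIV_exp] show ?thesis
      using g\<mu>[OF that] by (simp add: \<mu>_def divide_inverse mult.commute)
  qed
  let ?G = "{\<mu>, \<lambda>t. C_eps \<epsilon> (\<mu> t), \<lambda>t. S_eps \<epsilon> (\<mu> t), \<lambda>t. 1 / g' (\<mu> t)}"
  let ?\<A> = "function_algebra ?G"
  have comp: "(\<lambda>t. f (\<mu> t)) \<in> ?\<A>" if "f \<in> function_algebra ?T" for f
    by (rule function_algebra_compose[OF that]) (auto intro: function_algebra.gen)
  have r: "(\<lambda>t. 1 / g' (\<mu> t)) \<in> ?\<A>" by (rule function_algebra.gen) simp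
  define \<mu>' where "\<mu>' = (\<lambda>t. ?g (\<mu> t) * (1 / g' (\<mu> t)))"
  have \<mu>': "\<mu>' \<in> ?\<A>"
    unfolding \<mu>'_def by (intro function_algebra.mult comp r parallel_jacobian_in_algebra)
  have D\<mu>': "(\<mu> has_real_derivative \<mu>' t) (at t)" if "t \<in> I" for t
    using D\<mu>[OF that] by (simp add: \<mu>'_def)
  have trig: "C_eps \<epsilon> \<in> function_algebra ?T" "S_eps \<epsilon> \<in> function_algebra ?T"
    by (auto intro: function_algebra.gen)
  have "smooth_on I \<mu>"
  proof (rule smooth_on_if_closed_under_derivatives)
    show "\<mu> \<in> ?\<A>" by (rule function_algebra.gen) simp
    fix f assume "f \<in> ?\<A>"
    then show "\<exists>f'\<in>?\<A>. \<forall>t\<in>I. (f has_real_derivative f' t) (at t)"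
    proof (rule function_algebra_derivative[rotated])
      fix f assume "f \<in> ?G"
      then consider "f = \<mu>" | "f = (\<lambda>t. C_eps \<epsilon> (\<mu> t))" | "f = (\<lambda>t. S_eps \<epsilon> (\<mu> t))"
        | "f = (\<lambda>t. 1 / g' (\<mu> t))" by blast
      then show "\<exists>f'\<in>?\<A>. \<forall>t\<in>I. (f has_real_derivative f' t) (at t)"
      proof cases
        case 1
        then show ?thesis using derivative_in_setI[OF \<mu>' D\<mu>'] by simp
      next
        case 2
        have "(\<lambda>t. ((- \<epsilon>) * S_eps \<epsilon> (\<mu> t)) * \<mu>' t) \<in> ?\<A>"
          by (intro function_algebra.mult function_algebra.const comp trig \<mu>')
        moreover have "(f has_real_derivative ((- \<epsilon>) * S_eps \<epsilon> (\<mu> t)) * \<mu>' t) (at t)" if "t \<in> I" for t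
          using DERIV_chain2[OF DERIV_C_eps[OF eps] D\<mu>'[OF that]] 2 by simp
        ultimately show ?thesis by (rule derivative_in_setI)
      next
        case 3
        have "(\<lambda>t. C_eps \<epsilon> (\<mu> t) * \<mu>' t) \<in> ?\<A>"
          by (intro function_algebra.mult comp trig \<mu>')
        moreover have "(f has_real_derivative C_eps \<epsilon> (\<mu> t) * \<mu>' t) (at t)" if "t \<in> I" for t
          using DERIV_chain2[OF DERIV_S_eps[OF eps] D\<mu>'[OF that]] 3 by simp
        ultimately show ?thesis by (rule derivative_in_setI)
      next
        case 4
        have "(\<lambda>t. (-1) * (g'' (\<mu> t) * \<mu>' t * ((1 / g' (\<mu> t)) * (1 / g' (\<mu> t))))) \<in> ?\<A>"
          by (intro function_algebra.mult function_algebra.const comp g'' \<mu>' r)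
        moreover have "(f has_real_derivative (-1) * (g'' (\<mu> t) * \<mu>' t * ((1 / g' (\<mu> t)) * (1 / g' (\<mu> t))))) (at t)"
          if "t \<in> I" for t
        proof -
          have "((\<lambda>t. g' (\<mu> t)) has_real_derivative g'' (\<mu> t) * \<mu>' t) (at t)"
            by (rule DERIV_chain2[OF g''(2) D\<mu>'[OF that]])
          from DERIV_inverse'[OF this nz[OF that]] show ?thesis
            unfolding 4 by (simp add: inverse_eq_divide)
        qed
        ultimately show ?thesis by (rule derivative_in_setI)
      qed
    qed
  qed (use I in \<open>simp add: open_interval_around_0_def\<close>)
  moreover have "\<mu> 0 = 0" using ab by (simp add: \<mu>_def)
  ultimately show thesis using that I g\<mu> by blast
qed

text \<open>Divided by a power of \<open>S\<close>, the Jacobian is the monic polynomial with root multiset \<open>M\<close>, evaluated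
  at \<open>C / S\<close>. Since \<open>S(\<mu>(t))\<close> tends to \<open>0\<close> without vanishing for \<open>t \<noteq> 0\<close> close to \<open>0\<close>, the quotient
  is unbounded, and the two polynomials share infinitely many values.

  The sizes must be assumed equal: for \<open>\<epsilon> = 0\<close> the eigenvalue \<open>0\<close> contributes the factor \<open>1\<close>, and
  for \<open>\<epsilon> = -1\<close> the pair \<open>1, -1\<close> does, so the Jacobian alone does not determine \<open>M\<close>.\<close>

lemma multiset_eq_if_parallel_jacobians_agree:
  assumes eps: "\<epsilon> \<in> {-1, 0, 1}" and size: "size M = size M'"
    and I: "open I" "0 \<in> I" and \<mu>0: "\<mu> 0 = 0"
    and \<mu>: "(\<mu> has_real_derivative d) (at 0)" "d \<noteq> 0"
    and eq: "\<And>t. t \<in> I \<Longrightarrow> parallel_jacobian \<epsilon> M (\<mu> t) = parallel_jacobian \<epsilon> M' (\<mu> t)"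
  shows "M = M'"
proof -
  define P where "P M = (\<Prod>k\<in>#M. [:- k, 1:])" for M :: "real multiset"
  have P_nz: "P M \<noteq> 0" for M by (auto simp: P_def prod_mset_zero_iff)
  have proots: "proots (P M) = M" for M
  proof (induction M)
    case (add k M)
    have "proots (P (add_mset k M)) = proots [:- k, 1:] + proots (P M)"
      using P_nz[of M] by (simp add: P_def proots_mult del: mult_pCons_left)
    then show ?case using add by simp
  qed (simp add: P_def)
  have factor: "parallel_jacobian \<epsilon> M m = S_eps \<epsilon> m ^ size M * poly (P M) (C_eps \<epsilon> m / S_eps \<epsilon> m)"
    if "S_eps \<epsilon> m \<noteq> 0" for M m
    using that by (induction M) (auto simp: parallel_jacobian_def P_def field_simps)
  let ?q = "P M - P M'"
  have root: "poly ?q (C_eps \<epsilon> (\<mu> t) / S_eps \<epsilon> (\<mu> t)) = 0" if "t \<in> I" "S_eps \<epsilon> (\<mu> t) \<noteq> 0" for t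
    using eq[OF that(1)] that(2) by (simp add: factor size)
  have "?q = 0"
  proof (rule ccontr)
    assume "?q \<noteq> 0"
    then have "bounded {z. poly ?q z = 0}" by (intro finite_imp_bounded poly_roots_finite)
    then obtain B where B: "\<And>z. poly ?q z = 0 \<Longrightarrow> norm z \<le> B"
      unfolding bounded_iff by blast
    have DS: "((\<lambda>t. S_eps \<epsilon> (\<mu> t)) has_real_derivative d) (at 0)"
      using DERIV_chain2[OF DERIV_S_eps[OF eps] \<mu>(1)] \<mu>0 by simp
    have DC: "((\<lambda>t. C_eps \<epsilon> (\<mu> t)) has_real_derivative 0) (at 0)"
      using DERIV_chain2[OF DERIV_C_eps[OF eps] \<mu>(1)] \<mu>0 by simp
    have "((\<lambda>t. S_eps \<epsilon> (\<mu> t) / t) \<longlongrightarrow> d) (at 0)"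
      using DS \<mu>0 by (simp add: has_field_derivative_iff)
    from tendsto_imp_eventually_ne[OF this \<mu>(2)]
    have nz: "eventually (\<lambda>t. S_eps \<epsilon> (\<mu> t) \<noteq> 0) (at 0)" by (rule eventually_mono) auto
    have "((\<lambda>t. S_eps \<epsilon> (\<mu> t)) \<longlongrightarrow> 0) (at 0)" "((\<lambda>t. C_eps \<epsilon> (\<mu> t)) \<longlongrightarrow> 1) (at 0)"
      using DERIV_isCont[OF DS] DERIV_isCont[OF DC] \<mu>0 by (simp_all add: isCont_def)
    then have lim: "filterlim (\<lambda>t. C_eps \<epsilon> (\<mu> t) / S_eps \<epsilon> (\<mu> t)) at_infinity (at 0)"
      using nz by (intro filterlim_divide_at_infinity[of _ 1]) (auto simp: filterlim_at)
    have "eventually (\<lambda>z::real. norm z \<ge> B + 1) at_infinity"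
      unfolding eventually_at_infinity by blast
    then have "eventually (\<lambda>t. norm (C_eps \<epsilon> (\<mu> t) / S_eps \<epsilon> (\<mu> t)) \<ge> B + 1) (at 0)"
      using lim[unfolded filterlim_iff] by blast
    moreover have "eventually (\<lambda>t. t \<in> I) (at 0)" using I by (rule eventually_at_in_open')
    ultimately have "eventually (\<lambda>t::real. False) (at 0)"
      using nz
    proof eventually_elim
      case (elim t)
      then show ?case using B[OF root[of t]] by simp
    qed
    then show False by simp
  qed
  then have "proots (P M) = proots (P M')" by simp
  then show ?thesis by (simp add: proots)
qed

section \<open>Principal curvatures of a hypersurface\<close>

locale smooth_manifold =
  fixes A :: "('m::{t2_space,second_countable_topology}, 'n::finite) chart set"
  assumes atlas: "smooth_atlas A"
begin

lemma chart_at_in: "chart_at A x \<in> A" and chart_at_dom: "x \<in> fst (chart_at A x)"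
proof -
  have "\<exists>c. c \<in> A \<and> x \<in> fst c" using atlas unfolding smooth_atlas_def by blast
  from someI_ex[OF this] show "chart_at A x \<in> A" "x \<in> fst (chart_at A x)"
    by (auto simp: chart_at_def)
qed

lemma chart_homeomorphism:
  "c \<in> A \<Longrightarrow> homeomorphism (fst c) (snd c ` fst c) (snd c) (chart_inv c)"
  and open_chart_image: "c \<in> A \<Longrightarrow> open (snd c ` fst c)"
  and open_chart_dom: "c \<in> A \<Longrightarrow> open (fst c)"
  using atlas unfolding smooth_atlas_def by blast+

lemma chart_inv_apply: "c \<in> A \<Longrightarrow> x \<in> fst c \<Longrightarrow> chart_inv c (snd c x) = x"
  using homeomorphism_apply1[OF chart_homeomorphism] .

lemma smooth_map_chart:
  "smooth_map A G \<Longrightarrow> c \<in> A \<Longrightarrow> smooth_on (snd c ` fst c) (G \<circ> chart_inv c)"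
  by (simp add: smooth_map_def)

lemma differential_works:
  assumes "smooth_map A G"
  shows "((G \<circ> chart_inv (chart_at A x)) has_derivative differential A G x) (at (snd (chart_at A x) x))"
proof -
  have "(G \<circ> chart_inv (chart_at A x)) differentiable (at (snd (chart_at A x) x))"
    using smooth_on_differentiable[OF smooth_map_chart[OF assms chart_at_in]] chart_at_dom by blast
  then show ?thesis unfolding differential_def using frechet_derivative_works by blast
qed

lemma linear_differential: "smooth_map A G \<Longrightarrow> linear (differential A G x)"
  using differential_works has_derivative_linear by blast

lemma smooth_map_linear_combination:
  assumes "smooth_map A G" "smooth_map A H"
  shows "smooth_map A (\<lambda>x. a *\<^sub>R G x + b *\<^sub>R H x)"
  using assms smooth_on_linear_combination[OF open_chart_image]
  unfolding smooth_map_def comp_def by blast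

lemma differential_linear_combination:
  assumes "smooth_map A G" "smooth_map A H"
  shows "differential A (\<lambda>x. a *\<^sub>R G x + b *\<^sub>R H x) x v =
    a *\<^sub>R differential A G x v + b *\<^sub>R differential A H x v"
proof -
  have "((\<lambda>y. a *\<^sub>R (G \<circ> chart_inv (chart_at A x)) y + b *\<^sub>R (H \<circ> chart_inv (chart_at A x)) y)
     has_derivative (\<lambda>v. a *\<^sub>R differential A G x v + b *\<^sub>R differential A H x v)) (at (snd (chart_at A x) x))"
    by (intro derivative_intros differential_works assms)
  from frechet_derivative_at[OF this] show ?thesis
    by (simp add: differential_def comp_def fun_eq_iff)
qed

lemma differential_constant_pairing:
  assumes "bounded_bilinear h" "smooth_map A G" "smooth_map A H" "\<And>x. h (G x) (H x) = c"
  shows "h (differential A G x v) (H x) + h (G x) (differential A H x v) = 0"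
proof -
  let ?c = "chart_at A x"
  have "((\<lambda>y. h ((G \<circ> chart_inv ?c) y) ((H \<circ> chart_inv ?c) y)) has_derivative
    (\<lambda>v. h ((G \<circ> chart_inv ?c) (snd ?c x)) (differential A H x v)
       + h (differential A G x v) ((H \<circ> chart_inv ?c) (snd ?c x)))) (at (snd ?c x))"
    by (intro bounded_bilinear.FDERIV[OF assms(1)] differential_works assms)
  then have "((\<lambda>y. c) has_derivative
    (\<lambda>v. h (G x) (differential A H x v) + h (differential A G x v) (H x))) (at (snd ?c x))"
    by (simp add: assms(4) chart_inv_apply[OF chart_at_in chart_at_dom])
  from has_derivative_unique[OF this has_derivative_const]
  show ?thesis by (metis add.commute)
qed

text \<open>The differential at a point uses the chart chosen there, and a derivative in another chart
  differs from it by the derivative of a transition map. The lemma carries an identity that is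
  known at each point in its own chart over to a single chart, where it can be differentiated.\<close>

lemma frechet_derivative_in_range_differential:
  assumes "smooth_map A G" "c \<in> A" "x \<in> fst c"
  shows "frechet_derivative (G \<circ> chart_inv c) (at (snd c x)) v \<in> range (differential A G x)"
proof -
  let ?d = "chart_at A x"
  let ?T = "snd ?d \<circ> chart_inv c"
  let ?V = "snd c ` (fst c \<inter> fst ?d)"
  have "openin (top_of_set (fst c)) (fst c \<inter> fst ?d)"
    using open_chart_dom[OF chart_at_in] by (simp add: openin_open_Int)
  then have "openin (top_of_set (snd c ` fst c)) ?V"
    using homeomorphism_imp_open_map[OF chart_homeomorphism[OF assms(2)]] by blast
  then have V: "open ?V" "snd c x \<in> ?V"
    using open_chart_image[OF assms(2)] openin_open_eq chart_at_dom assms(3) by blast+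
  have "smooth_on ?V ?T" using atlas assms(2) chart_at_in[of x] unfolding smooth_atlas_def by blast
  then have T: "(?T has_derivative frechet_derivative ?T (at (snd c x))) (at (snd c x))"
    using smooth_on_differentiable[OF _ V(2)] frechet_derivative_works by blast
  have Tx: "?T (snd c x) = snd ?d x" by (simp add: chart_inv_apply assms)
  have "((G \<circ> chart_inv ?d) \<circ> ?T has_derivative
      differential A G x \<circ> frechet_derivative ?T (at (snd c x))) (at (snd c x))"
    using diff_chain_at[OF T] differential_works[OF assms(1), of x] Tx by metis
  moreover have "((G \<circ> chart_inv ?d) \<circ> ?T) y = (G \<circ> chart_inv c) y" if y: "y \<in> ?V" for y
  proof -
    obtain z where z: "z \<in> fst c" "z \<in> fst ?d" "y = snd c z" using y by blast
    show ?thesis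
      by (simp add: z(3) chart_inv_apply[OF assms(2) z(1)] chart_inv_apply[OF chart_at_in z(2)])
  qed
  ultimately have "((G \<circ> chart_inv c) has_derivative
      differential A G x \<circ> frechet_derivative ?T (at (snd c x))) (at (snd c x))"
    using has_derivative_transform_within_open[OF _ V] by blast
  from frechet_derivative_at[OF this, symmetric] show ?thesis by simp
qed

end

locale oriented_hypersurface = smooth_manifold A
  for A :: "('m::{t2_space,second_countable_topology}, 'n::finite) chart set" +
  fixes \<epsilon> :: real and p :: "'q::finite" and F N :: "'m \<Rightarrow> real^'q"
  assumes eps: "\<epsilon> \<in> {-1, 0, 1}"
    and codimension: "CARD('q) = CARD('n) + (if \<epsilon> = 0 then 1 else 2)"
    and hyp: "hypersurface \<epsilon> p A F"
    and normal: "unit_normal \<epsilon> p A F N"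
begin

abbreviation form where "form \<equiv> ambient_form \<epsilon> p"
abbreviation dF where "dF \<equiv> differential A F"
abbreviation dN where "dN \<equiv> differential A N"
abbreviation E where "E \<equiv> curvature_eigenspace \<epsilon> p A F N"
abbreviation curvatures where "curvatures \<equiv> principal_curvatures \<epsilon> p A F N"

lemma smooth_F: "smooth_map A F" and smooth_N: "smooth_map A N"
  and F_in: "F x \<in> space_form \<epsilon> p" and inj_dF: "inj (dF x)"
  using hyp normal by (auto simp: hypersurface_def unit_normal_def)

lemmas linear_dF = linear_differential[OF smooth_F]
lemmas linear_dN = linear_differential[OF smooth_N]

lemma dF_eq_0_iff: "dF x v = 0 \<longleftrightarrow> v = 0"
  using linear_injective_0[OF linear_dF] inj_dF linear_0[OF linear_dF] by blast

lemma bounded_bilinear_form: "bounded_bilinear form"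
  using bilinear_ambient_form bilinear_conv_bounded_bilinear by blast

lemma form_N_F: "\<epsilon> \<noteq> 0 \<Longrightarrow> form (N x) (F x) = 0"
  and form_N_N: "form (N x) (N x) = 1"
  and form_N_dF: "form (N x) (dF x v) = 0"
  and form_F_F: "\<epsilon> \<noteq> 0 \<Longrightarrow> form (F x) (F x) = \<epsilon>"
  using normal ambient_form_space_form[OF eps _ F_in] by (auto simp: unit_normal_def)

lemma form_F_dF: "\<epsilon> \<noteq> 0 \<Longrightarrow> form (F x) (dF x v) = 0"
  using differential_constant_pairing[OF bounded_bilinear_form smooth_F smooth_F form_F_F, of x v]
  by (simp add: ambient_form_commute[of _ _ _ "F x"])

lemma form_N_dN: "form (N x) (dN x v) = 0"
  using differential_constant_pairing[OF bounded_bilinear_form smooth_N smooth_N form_N_N, of x v]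
  by (simp add: ambient_form_commute[of _ _ _ "N x"])

lemma form_F_dN: "\<epsilon> \<noteq> 0 \<Longrightarrow> form (F x) (dN x v) = 0"
  using differential_constant_pairing[OF bounded_bilinear_form smooth_N smooth_F form_N_F, of x v]
  by (simp add: ambient_form_commute[of _ _ _ "F x"] form_N_dF)

text \<open>The tangent space has dimension \<open>n\<close>; together with \<open>N x\<close>, and with the position vector if
  \<open>\<epsilon> \<noteq> 0\<close>, it spans the ambient space, on which the form is nondegenerate. This is where the
  hypersurface is required to have codimension one in the space form.\<close>

lemma normal_space_complement:
  assumes "\<epsilon> \<noteq> 0 \<Longrightarrow> form z (F x) = 0" "form z (N x) = 0" "\<And>w. form z (dF x w) = 0"
  shows "z = 0"
proof -
  have vanish: "form u y = 0" if "y \<in> span S" "\<And>y. y \<in> S \<Longrightarrow> form u y = 0" for u y S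
    using that(1)
    by (induction rule: span_induct) (auto simp: subspace_def ambient_form_simps that(2))
  let ?R = "range (dF x)"
  let ?S = "if \<epsilon> = 0 then insert (N x) ?R else insert (F x) (insert (N x) ?R)"
  have dimR: "dim ?R = CARD('n)"
    using dim_image_eq[OF linear_dF, of x UNIV] inj_dF by (simp add: dim_UNIV)
  have "N x \<notin> span ?R" using vanish[of "N x" ?R "N x"] form_N_dF form_N_N[of x] by fastforce
  then have dimN: "dim (insert (N x) ?R) = CARD('n) + 1" using dimR by (simp add: dim_insert)
  have "dim ?S = CARD('q)"
  proof (cases "\<epsilon> = 0")
    case False
    have "form (F x) y = 0" if "y \<in> insert (N x) ?R" for y
      using that form_F_dF[OF False] form_N_F[OF False] ambient_form_commute[of \<epsilon> p "F x" "N x"] by auto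
    then have "F x \<notin> span (insert (N x) ?R)"
      using vanish[of "F x" "insert (N x) ?R" "F x"] form_F_F[OF False, of x] False by metis
    then show ?thesis using dimN False codimension by (simp add: dim_insert)
  qed (use dimN codimension in simp)
  then have "span ?S = UNIV" using dim_eq_full[of ?S] by simp
  moreover have "form z y = 0" if "y \<in> ?S" for y
    using that assms by (auto split: if_splits)
  ultimately have "form z y = 0" for y using vanish[of y ?S z] by blast
  then show ?thesis by (rule ambient_form_nondegenerate)
qed

text \<open>The Weingarten equation: \<open>dN\<close> takes tangential values, so it is determined by its pairing with
  the tangent vectors. In this form the eigenspaces can be followed along parallel hypersurfaces
  without reference to the induced metric.\<close>

lemma eigenspace_eq: "E x k = {v. dN x v = - k *\<^sub>R dF x v}"
proof -
  have "v \<in> E x k \<longleftrightarrow> dN x v = - k *\<^sub>R dF x v" for v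
  proof
    assume v: "v \<in> E x k"
    have "dN x v + k *\<^sub>R dF x v = 0"
    proof (rule normal_space_complement[of _ x])
      show "form (dN x v + k *\<^sub>R dF x v) (F x) = 0" if "\<epsilon> \<noteq> 0"
        using form_F_dF[OF that] form_F_dN[OF that]
        by (simp add: ambient_form_simps ambient_form_commute[of _ _ _ "F x"])
      show "form (dN x v + k *\<^sub>R dF x v) (N x) = 0"
        using form_N_dF form_N_dN by (simp add: ambient_form_simps ambient_form_commute[of _ _ _ "N x"])
      show "form (dN x v + k *\<^sub>R dF x v) (dF x w) = 0" for w
      proof -
        have "- form (dN x v) (dF x w) = k * form (dF x v) (dF x w)"
          using v by (simp add: curvature_eigenspace_def first_form_def second_form_def)
        then show ?thesis by (simp add: ambient_form_simps)
      qed
    qed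
    then show "dN x v = - k *\<^sub>R dF x v" by (simp add: add_eq_0_iff2)
  next
    assume "dN x v = - k *\<^sub>R dF x v"
    then show "v \<in> E x k"
      by (simp add: curvature_eigenspace_def first_form_def second_form_def ambient_form_simps)
  qed
  then show ?thesis by blast
qed

text \<open>Differentiating \<open>\<langle>N, dF w\<rangle> = 0\<close> in the direction \<open>v\<close> expresses the second fundamental form as
  \<open>\<langle>N, d\<^sup>2F(v, w)\<rangle>\<close>, and second derivatives are symmetric.\<close>

lemma second_form_symmetric:
  "second_form \<epsilon> p A F N x v w = second_form \<epsilon> p A F N x w v"
proof -
  let ?c = "chart_at A x"
  let ?U = "snd ?c ` fst ?c" and ?y = "snd ?c x"
  let ?f = "F \<circ> chart_inv ?c" and ?n = "N \<circ> chart_inv ?c"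
  let ?df = "\<lambda>w y. frechet_derivative ?f (at y) w"
  have U: "open ?U" "?y \<in> ?U" using open_chart_image[OF chart_at_in] chart_at_dom by blast+
  have smooth: "smooth_on ?U ?f" using smooth_map_chart[OF smooth_F chart_at_in] .
  have "second_form \<epsilon> p A F N x v w = form (N x) (frechet_derivative (?df w) (at ?y) v)" for v w
  proof -
    have "?df w differentiable (at ?y)"
      using smooth_on_differentiable[OF smooth_on_frechet_derivative[OF smooth] U(2)] .
    then have "(?df w has_derivative frechet_derivative (?df w) (at ?y)) (at ?y)"
      using frechet_derivative_works by blast
    from bounded_bilinear.FDERIV[OF bounded_bilinear_form differential_works[OF smooth_N] this]
    have D: "((\<lambda>y. form (?n y) (?df w y)) has_derivative
       (\<lambda>v. form (?n ?y) (frechet_derivative (?df w) (at ?y) v) + form (dN x v) (?df w ?y))) (at ?y)" .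
    have "form (?n y) (?df w y) = 0" if y: "y \<in> ?U" for y
    proof -
      obtain z where z: "z \<in> fst ?c" "y = snd ?c z" using y by blast
      obtain u where "?df w y = dF z u"
        using frechet_derivative_in_range_differential[OF smooth_F chart_at_in z(1), of w] z(2) by blast
      then show ?thesis using form_N_dF by (simp add: z chart_inv_apply[OF chart_at_in z(1)])
    qed
    from has_derivative_transform_within_open[OF D U this]
    have "((\<lambda>y. 0) has_derivative
       (\<lambda>v. form (?n ?y) (frechet_derivative (?df w) (at ?y) v) + form (dN x v) (?df w ?y))) (at ?y)"
      by simp
    from fun_cong[OF has_derivative_unique[OF this has_derivative_const], of v]
    have "form (N x) (frechet_derivative (?df w) (at ?y) v) + form (dN x v) (dF x w) = 0"
      by (simp add: chart_inv_apply[OF chart_at_in chart_at_dom] differential_def)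
    then show ?thesis by (simp add: second_form_def)
  qed
  then show ?thesis using symmetric_second_derivative[OF U smooth, of v w] by simp
qed

lemma self_adjoint_pencil_forms:
  "self_adjoint_pencil (first_form \<epsilon> p A F x) (second_form \<epsilon> p A F N x)"
proof
  have bil: "bilinear (\<lambda>v w. c * form (L v) (dF x w))" if "linear L" for c L
    unfolding bilinear_def
    by (auto intro!: linearI simp: linear_add[OF that] linear_add[OF linear_dF] linear_cmul[OF that]
        linear_cmul[OF linear_dF] ambient_form_simps algebra_simps)
  show "bilinear (first_form \<epsilon> p A F x)"
    using bil[OF linear_dF, of 1] by (simp add: first_form_def[abs_def])
  show "bilinear (second_form \<epsilon> p A F N x)"
    using bil[OF linear_dN, of "-1"] by (simp add: second_form_def[abs_def])
  show "first_form \<epsilon> p A F x v w = first_form \<epsilon> p A F x w v" for v w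
    by (simp add: first_form_def ambient_form_commute)
  show "first_form \<epsilon> p A F x v v > 0" if "v \<noteq> 0" for v
    unfolding first_form_def
    using ambient_form_positive_on_tangent_space[OF eps F_in] form_F_dF that dF_eq_0_iff
    by (metis ambient_form_commute)
qed (rule second_form_symmetric)

text \<open>Since the eigenvalues are counted with the dimensions of their eigenspaces, the second statement
  says that the shape operator is diagonalizable.\<close>

lemma finite_spectrum: "finite {k. E x k \<noteq> {0}}"
  and size_curvatures: "size (curvatures x) = CARD('n)"
proof -
  interpret self_adjoint_pencil "first_form \<epsilon> p A F x" "second_form \<epsilon> p A F N x"
    by (rule self_adjoint_pencil_forms)
  have "eigenspace = E x" by (auto simp: eigenspace_def curvature_eigenspace_def fun_eq_iff)
  then show fin: "finite {k. E x k \<noteq> {0}}" and "size (curvatures x) = CARD('n)"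
    using eigenvalues_finite_and_complete
    by (simp_all add: principal_curvatures_def eigenvalue_multiset)
qed

lemma in_curvatures_iff: "k \<in># curvatures x \<longleftrightarrow> (\<exists>v. v \<noteq> 0 \<and> dN x v = - k *\<^sub>R dF x v)"
proof -
  have 0: "0 \<in> E x k" for k by (simp add: eigenspace_eq linear_0[OF linear_dN] linear_0[OF linear_dF])
  have "k \<in># curvatures x \<longleftrightarrow> E x k \<noteq> {0} \<and> \<not> E x k \<subseteq> {0}"
    unfolding principal_curvatures_def eigenvalue_multiset(2)[OF finite_spectrum]
    by (simp add: dim_eq_0[symmetric] del: dim_eq_0)
  also have "\<dots> \<longleftrightarrow> (\<exists>v. v \<noteq> 0 \<and> v \<in> E x k)" using 0 by blast
  finally show ?thesis by (simp add: eigenspace_eq)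
qed

end

section \<open>Parallel hypersurfaces\<close>

context oriented_hypersurface
begin

lemma scaled_normal:
  assumes "\<sigma>\<^sup>2 = 1"
  shows "unit_normal \<epsilon> p A F (\<lambda>x. \<sigma> *\<^sub>R N x)"
    and "mean_curvature \<epsilon> p A F (\<lambda>x. \<sigma> *\<^sub>R N x) x = \<sigma> * mean_curvature \<epsilon> p A F N x"
proof -
  have \<sigma>: "\<sigma> * \<sigma> = 1" "\<sigma> \<noteq> 0" using assms by (auto simp: power2_eq_square)
  have "smooth_map A (\<lambda>x. \<sigma> *\<^sub>R N x)"
    using smooth_map_linear_combination[OF smooth_N smooth_N, of \<sigma> 0] by simp
  then show un: "unit_normal \<epsilon> p A F (\<lambda>x. \<sigma> *\<^sub>R N x)"
    using normal \<sigma> by (auto simp: unit_normal_def ambient_form_simps)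
  interpret P: oriented_hypersurface A \<epsilon> p F "\<lambda>x. \<sigma> *\<^sub>R N x"
    by unfold_locales (use eps codimension hyp un in auto)
  have d: "differential A (\<lambda>x. \<sigma> *\<^sub>R N x) x v = \<sigma> *\<^sub>R dN x v" for v
    using differential_linear_combination[OF smooth_N smooth_N, of \<sigma> 0] by simp
  have E: "P.E x (\<sigma> * k) = E x k" for k
    unfolding P.eigenspace_eq eigenspace_eq d
    using \<sigma>(2) by (simp add: scaleR_scaleR[symmetric] del: scaleR_scaleR flip: scaleR_minus_right)
  have "principal_curvatures \<epsilon> p A F (\<lambda>x. \<sigma> *\<^sub>R N x) x = image_mset ((*) \<sigma>) (curvatures x)"
    unfolding principal_curvatures_def
  proof (rule eigenvalue_multiset_reparametrize[OF finite_spectrum])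
    show "P.E x (\<sigma> * k) = E x k" for k by (rule E)
    show "\<exists>k. E x k \<noteq> {0} \<and> \<sigma> * k = l" if "P.E x l \<noteq> {0}" for l
      using that E[of "\<sigma> * l"] \<sigma> by (intro exI[of _ "\<sigma> * l"]) (simp add: mult.assoc[symmetric])
    show "inj_on ((*) \<sigma>) {k. E x k \<noteq> {0}}" using \<sigma>(2) by (simp add: inj_on_def)
  qed
  then show "mean_curvature \<epsilon> p A F (\<lambda>x. \<sigma> *\<^sub>R N x) x = \<sigma> * mean_curvature \<epsilon> p A F N x"
    using sum_mset_distrib_left[of \<sigma> "\<lambda>k. k" "curvatures x"] by (simp add: mean_curvature_def)
qed

abbreviation C where "C \<equiv> C_eps \<epsilon>"
abbreviation S where "S \<equiv> S_eps \<epsilon>"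

definition parallel :: "real \<Rightarrow> 'm \<Rightarrow> real^'q" where
  "parallel m x = C m *\<^sub>R F x + S m *\<^sub>R N x"

definition parallel_normal :: "real \<Rightarrow> 'm \<Rightarrow> real^'q" where
  "parallel_normal m x = (- (\<epsilon> * S m)) *\<^sub>R F x + C m *\<^sub>R N x"

lemma smooth_parallel: "smooth_map A (parallel m)" "smooth_map A (parallel_normal m)"
  unfolding parallel_def[abs_def] parallel_normal_def[abs_def]
  by (intro smooth_map_linear_combination smooth_F smooth_N)+

lemma differential_parallel:
  "differential A (parallel m) x v = C m *\<^sub>R dF x v + S m *\<^sub>R dN x v"
  "differential A (parallel_normal m) x v = (- (\<epsilon> * S m)) *\<^sub>R dF x v + C m *\<^sub>R dN x v"
  unfolding parallel_def[abs_def] parallel_normal_def[abs_def]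
  by (rule differential_linear_combination[OF smooth_F smooth_N])+

lemma C_S_identity: "C m * C m + \<epsilon> * S m * S m = 1"
  using C_S_eps_identity[OF eps, of m] by (simp add: power2_eq_square mult.assoc)

lemma parallel_in_space_form: "parallel m x \<in> space_form \<epsilon> p"
  unfolding parallel_def
  by (rule space_form_geodesic[OF eps F_in]) (auto simp: form_N_F form_N_N)

lemma unit_normal_parallel: "unit_normal \<epsilon> p A (parallel m) (parallel_normal m)"
proof -
  have F_N: "form (F x) (N x) = 0" if "\<epsilon> \<noteq> 0" for x
    using form_N_F[OF that] by (simp add: ambient_form_commute[of _ _ "F x"])
  have 1: "form (parallel_normal m x) (parallel m x) = 0" if "\<epsilon> \<noteq> 0" for x
  proof -
    have "form (parallel_normal m x) (parallel m x) = C m * S m - \<epsilon> * \<epsilon> * (S m * C m)"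
      unfolding parallel_def parallel_normal_def
      by (simp add: ambient_form_simps F_N[OF that] form_N_F[OF that] form_F_F[OF that] form_N_N algebra_simps)
    moreover have "\<epsilon> * \<epsilon> = 1" using eps that by auto
    ultimately show ?thesis by simp
  qed
  have 2: "form (parallel_normal m x) (parallel_normal m x) = 1" for x
  proof (cases "\<epsilon> = 0")
    case True
    then have "parallel_normal m x = N x" unfolding parallel_normal_def by (simp add: C_eps_def)
    then show ?thesis by (simp only: form_N_N)
  next
    case False
    have "form (parallel_normal m x) (parallel_normal m x) = \<epsilon> * \<epsilon> * (\<epsilon> * S m * S m) + C m * C m"
      unfolding parallel_normal_def
      by (simp add: ambient_form_simps F_N[OF False] form_N_F[OF False] form_F_F[OF False] form_N_N algebra_simps)
    moreover have "\<epsilon> * \<epsilon> = 1" using eps False by auto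
    ultimately show ?thesis using C_S_identity[of m] by simp
  qed
  have 3: "form (parallel_normal m x) (differential A (parallel m) x v) = 0" for x v
    unfolding differential_parallel parallel_normal_def
    using form_F_dF[of x v] form_F_dN[of x v] form_N_dF[of x v] form_N_dN[of x v]
    by (cases "\<epsilon> = 0") (simp_all add: ambient_form_simps)
  show ?thesis using 1 2 3 smooth_parallel by (simp add: unit_normal_def)
qed

text \<open>On a principal direction for \<open>k\<close> the differential of the parallel map is \<open>(C - k S) dF\<close>. A
  nonzero vector in its kernel is itself a principal direction, with curvature \<open>C / S\<close>.\<close>

lemma hypersurface_parallel_iff:
  "hypersurface \<epsilon> p A (parallel m) \<longleftrightarrow> (\<forall>x. \<forall>k\<in>#curvatures x. C m - k * S m \<noteq> 0)"
proof -
  have lin: "linear (differential A (parallel m) x)" for x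
    using linear_differential[OF smooth_parallel(1)] .
  have "inj (differential A (parallel m) x) \<longleftrightarrow> (\<forall>k\<in>#curvatures x. C m - k * S m \<noteq> 0)" for x
  proof
    assume inj: "inj (differential A (parallel m) x)"
    show "\<forall>k\<in>#curvatures x. C m - k * S m \<noteq> 0"
    proof
      fix k assume "k \<in># curvatures x"
      then obtain v where v: "v \<noteq> 0" "dN x v = - k *\<^sub>R dF x v" using in_curvatures_iff by blast
      have "differential A (parallel m) x v = (C m - k * S m) *\<^sub>R dF x v"
        by (simp add: differential_parallel v scaleR_diff_left mult.commute)
      moreover have "differential A (parallel m) x v \<noteq> 0"
        using inj v(1) linear_injective_0[OF lin] by blast
      ultimately show "C m - k * S m \<noteq> 0" by auto
    qed
  next
    assume nz: "\<forall>k\<in>#curvatures x. C m - k * S m \<noteq> 0"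
    show "inj (differential A (parallel m) x)"
      unfolding linear_injective_0[OF lin]
    proof (intro allI impI, rule ccontr)
      fix v assume v: "differential A (parallel m) x v = 0" "v \<noteq> 0"
      then have eq: "S m *\<^sub>R dN x v = - C m *\<^sub>R dF x v"
        by (simp add: differential_parallel add_eq_0_iff)
      show False
      proof (cases "S m = 0")
        case True
        then have "C m \<noteq> 0" using C_S_identity[of m] by auto
        then show False using eq True v(2) dF_eq_0_iff by simp
      next
        case False
        have "dN x v = (1 / S m) *\<^sub>R (S m *\<^sub>R dN x v)" using False by simp
        also have "\<dots> = - (C m / S m) *\<^sub>R dF x v" unfolding eq by simp
        finally have "C m / S m \<in># curvatures x" using in_curvatures_iff v(2) by blast
        then show False using nz False by auto
      qed
    qed
  qed
  then show ?thesis using smooth_parallel parallel_in_space_form by (simp add: hypersurface_def)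
qed

text \<open>For \<open>\<epsilon> = 1\<close> this is the addition theorem of the cotangent: the curvature \<open>cot \<theta>\<close> becomes
  \<open>cot (\<theta> - m)\<close>.\<close>

definition parallel_curvature :: "real \<Rightarrow> real \<Rightarrow> real" where
  "parallel_curvature m k = (k * C m + \<epsilon> * S m) / (C m - k * S m)"

text \<open>The equation \<open>dN\<^sub>m v = - l dF\<^sub>m v\<close> for the parallel hypersurface reads
  \<open>(C + l S) dN v = (\<epsilon> S - l C) dF v\<close>. By \<open>C\<^sup>2 + \<epsilon> S\<^sup>2 = 1\<close> the two coefficients do not vanish
  together, so for nonzero \<open>v\<close> this is an eigenvector equation for the initial hypersurface, with the
  curvature that the Moebius transformation \<open>parallel_curvature\<close> maps to \<open>l\<close>.\<close>

lemma curvatures_parallel: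
  assumes "hypersurface \<epsilon> p A (parallel m)"
  shows "principal_curvatures \<epsilon> p A (parallel m) (parallel_normal m) x =
    image_mset (parallel_curvature m) (curvatures x)"
proof -
  interpret P: oriented_hypersurface A \<epsilon> p "parallel m" "parallel_normal m"
    by unfold_locales (use eps codimension assms unit_normal_parallel in auto)
  have spectrum: "k \<in># curvatures x" if ne: "E x k \<noteq> {0}" for k
  proof -
    have "0 \<in> E x k" by (simp add: eigenspace_eq linear_0[OF linear_dN] linear_0[OF linear_dF])
    then obtain v where "v \<in> E x k" "v \<noteq> 0" using ne by blast
    then show ?thesis using in_curvatures_iff eigenspace_eq by blast
  qed
  have nz: "C m - k * S m \<noteq> 0" if "E x k \<noteq> {0}" for k
    using spectrum[OF that] assms hypersurface_parallel_iff by blast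
  have P_E: "P.E x l = {v. (C m + l * S m) *\<^sub>R dN x v = (\<epsilon> * S m - l * C m) *\<^sub>R dF x v}" for l
  proof -
    have "(differential A (parallel_normal m) x v = - l *\<^sub>R differential A (parallel m) x v) \<longleftrightarrow>
      (C m + l * S m) *\<^sub>R dN x v = (\<epsilon> * S m - l * C m) *\<^sub>R dF x v" for v
      unfolding differential_parallel by (simp add: algebra_simps)
    then show ?thesis unfolding P.eigenspace_eq by blast
  qed
  have fwd: "P.E x (parallel_curvature m k) = E x k" if "C m - k * S m \<noteq> 0" for k
  proof -
    let ?d = "C m - k * S m"
    have a: "C m + parallel_curvature m k * S m = 1 / ?d"
      using that C_S_identity[of m] by (simp add: parallel_curvature_def field_simps)
    have b: "\<epsilon> * S m - parallel_curvature m k * C m = (1 / ?d) * (- k)"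
    proof -
      have "\<epsilon> * S m - parallel_curvature m k * C m = - k * (C m * C m + \<epsilon> * S m * S m) / ?d"
        using that by (simp add: parallel_curvature_def field_simps)
      then show ?thesis using C_S_identity[of m] by simp
    qed
    show ?thesis
      unfolding P_E eigenspace_eq a b scaleR_scaleR[symmetric] scaleR_cancel_left using that by simp
  qed
  have inverse: "\<exists>k. E x k \<noteq> {0} \<and> parallel_curvature m k = l" if l: "P.E x l \<noteq> {0}" for l
  proof -
    let ?d = "C m + l * S m"
    have "0 \<in> P.E x l" by (simp add: P_E linear_0[OF linear_dN] linear_0[OF linear_dF])
    then obtain v where v: "v \<noteq> 0" "v \<in> P.E x l" using l by blast
    have d: "?d \<noteq> 0"
    proof
      assume 0: "?d = 0"
      then have "(\<epsilon> * S m - l * C m) *\<^sub>R dF x v = 0" using v(2) P_E[of l] by simp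
      then have 1: "\<epsilon> * S m = l * C m" using v(1) dF_eq_0_iff by simp
      have "C m * C m + \<epsilon> * S m * S m = C m * ?d" using 1 by (simp add: algebra_simps)
      then show False using 0 C_S_identity[of m] by simp
    qed
    \<comment> \<open>The inverse Moebius transformation applied to \<open>l\<close>.\<close>
    define k where "k = (l * C m - \<epsilon> * S m) / ?d"
    have kd: "C m - k * S m = 1 / ?d"
      using d C_S_identity[of m] by (simp add: k_def field_simps)
    have pk: "parallel_curvature m k = l"
    proof -
      have "parallel_curvature m k = (k * C m + \<epsilon> * S m) * ?d"
        unfolding parallel_curvature_def kd by simp
      also have "\<dots> = (l * C m - \<epsilon> * S m) * C m + \<epsilon> * S m * ?d"
        using d by (simp add: k_def distrib_right)
      also have "\<dots> = l * (C m * C m + \<epsilon> * S m * S m)" by (simp add: algebra_simps)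
      finally show ?thesis using C_S_identity[of m] by simp
    qed
    have "E x k = P.E x l" using fwd[of k] kd d pk by simp
    then show ?thesis using l pk by auto
  qed
  have inj: "inj_on (parallel_curvature m) {k. E x k \<noteq> {0}}"
  proof (rule inj_onI)
    fix k l assume kl: "k \<in> {k. E x k \<noteq> {0}}" "l \<in> {k. E x k \<noteq> {0}}"
      and eq: "parallel_curvature m k = parallel_curvature m l"
    have "(k * C m + \<epsilon> * S m) * (C m - l * S m) = (l * C m + \<epsilon> * S m) * (C m - k * S m)"
      using eq nz kl by (simp add: parallel_curvature_def frac_eq_eq)
    then have "k * (C m * C m + \<epsilon> * S m * S m) = l * (C m * C m + \<epsilon> * S m * S m)"
      by (simp add: algebra_simps)
    then show "k = l" using C_S_identity[of m] by simp
  qed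
  show ?thesis
    unfolding principal_curvatures_def
    by (rule eigenvalue_multiset_reparametrize[OF finite_spectrum fwd[OF nz] inverse inj])
qed

end

section \<open>The inverse mean curvature flow\<close>

context oriented_hypersurface
begin

abbreviation jacobian :: "'m \<Rightarrow> real \<Rightarrow> real" where
  "jacobian x \<equiv> parallel_jacobian \<epsilon> (curvatures x)"

definition parallel_mean_curvature :: "real \<Rightarrow> 'm \<Rightarrow> real" where
  "parallel_mean_curvature m x = (\<Sum>k\<in>#curvatures x. parallel_curvature m k)"

lemma mean_curvature_parallel:
  "hypersurface \<epsilon> p A (parallel m) \<Longrightarrow>
    mean_curvature \<epsilon> p A (parallel m) (parallel_normal m) x = parallel_mean_curvature m x"
  by (simp add: mean_curvature_def parallel_mean_curvature_def curvatures_parallel)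

lemma hypersurface_parallel_iff_jacobian:
  "hypersurface \<epsilon> p A (parallel m) \<longleftrightarrow> (\<forall>x. jacobian x m \<noteq> 0)"
  unfolding hypersurface_parallel_iff parallel_jacobian_def prod_mset_zero_iff set_image_mset image_iff
  by metis

lemma DERIV_jacobian:
  assumes "(\<mu> has_real_derivative \<mu>') (at t)" "hypersurface \<epsilon> p A (parallel (\<mu> t))"
  shows "((\<lambda>t. jacobian x (\<mu> t)) has_real_derivative
    - (\<mu>' * parallel_mean_curvature (\<mu> t) x) * jacobian x (\<mu> t)) (at t)"
proof -
  have "C (\<mu> t) - k * S (\<mu> t) \<noteq> 0" if "k \<in># curvatures x" for k
    using assms(2) that unfolding hypersurface_parallel_iff by blast
  from DERIV_chain2[OF DERIV_parallel_jacobian[OF eps this] assms(1)]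
  show ?thesis by (simp add: parallel_mean_curvature_def parallel_curvature_def mult_ac)
qed

lemma parallel_velocity:
  assumes "(\<mu> has_real_derivative \<mu>') (at t)"
  shows "((\<lambda>s. parallel (\<mu> s) x) has_vector_derivative \<mu>' *\<^sub>R parallel_normal (\<mu> t) x) (at t)"
proof -
  have "((\<lambda>s. C (\<mu> s)) has_real_derivative - (\<epsilon> * S (\<mu> t)) * \<mu>') (at t)"
    "((\<lambda>s. S (\<mu> s)) has_real_derivative C (\<mu> t) * \<mu>') (at t)"
    using DERIV_chain2[OF DERIV_C_eps[OF eps] assms] DERIV_chain2[OF DERIV_S_eps[OF eps] assms] by auto
  then show ?thesis
    unfolding parallel_def[abs_def] parallel_normal_def
    by (auto intro!: derivative_eq_intros simp: algebra_simps)
qed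

text \<open>The velocity is \<open>\<mu>'\<close> times the parallel normal, so the flow equation makes \<open>Nt\<close> proportional to
  this normal, with factor \<open>\<sigma> = \<plusminus>1\<close>. As the inward mean curvature is positive, \<open>\<sigma>\<close> is minus the sign
  of \<open>\<mu>'\<close> at every point. Changing the orientation multiplies both the normal and the mean curvature
  by \<open>\<sigma>\<close>, and \<open>\<sigma>\<close> drops out of the scalar equation.\<close>

lemma parallel_flow_equation_iff:
  assumes \<mu>: "(\<mu> has_real_derivative \<mu>') (at t)" and hyp_t: "hypersurface \<epsilon> p A (parallel (\<mu> t))"
  shows "(\<exists>Nt. inward_unit_normal \<epsilon> p A (parallel (\<mu> t)) Nt \<and>
      (\<forall>x. ((\<lambda>s. parallel (\<mu> s) x) has_vector_derivative
         - (1 / mean_curvature \<epsilon> p A (parallel (\<mu> t)) Nt x) *\<^sub>R Nt x) (at t))) \<longleftrightarrow>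
    (\<forall>x. \<mu>' * parallel_mean_curvature (\<mu> t) x = -1)"
    (is "?flow \<longleftrightarrow> _")
proof -
  let ?N = "parallel_normal (\<mu> t)"
  let ?H = "parallel_mean_curvature (\<mu> t)"
  interpret P: oriented_hypersurface A \<epsilon> p "parallel (\<mu> t)" ?N
    by unfold_locales (use eps codimension hyp_t unit_normal_parallel in auto)
  define \<sigma> where "\<sigma> = - sgn \<mu>'"
  have \<sigma>: "\<bar>\<mu>'\<bar> * \<sigma> = - \<mu>'" by (simp add: \<sigma>_def sgn_if abs_if)
  have mean: "mean_curvature \<epsilon> p A (parallel (\<mu> t)) (\<lambda>x. \<sigma> *\<^sub>R ?N x) x = \<sigma> * ?H x"
    and scaled: "unit_normal \<epsilon> p A (parallel (\<mu> t)) (\<lambda>x. \<sigma> *\<^sub>R ?N x)" if "\<mu>' \<noteq> 0" for x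
  proof -
    have "\<sigma>\<^sup>2 = 1" using that by (simp add: \<sigma>_def sgn_if)
    from P.scaled_normal[OF this]
    show "mean_curvature \<epsilon> p A (parallel (\<mu> t)) (\<lambda>x. \<sigma> *\<^sub>R ?N x) x = \<sigma> * ?H x"
      and "unit_normal \<epsilon> p A (parallel (\<mu> t)) (\<lambda>x. \<sigma> *\<^sub>R ?N x)"
      by (simp_all add: mean_curvature_parallel[OF hyp_t])
  qed
  show ?thesis
  proof
    assume ?flow
    then obtain Nt where Nt: "inward_unit_normal \<epsilon> p A (parallel (\<mu> t)) Nt"
      and vel: "\<And>x. ((\<lambda>s. parallel (\<mu> s) x) has_vector_derivative
         - (1 / mean_curvature \<epsilon> p A (parallel (\<mu> t)) Nt x) *\<^sub>R Nt x) (at t)" by blast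
    \<comment> \<open>From \<open>\<mu>\' N\<^sub>m = - Nt / h\<close> and the unit length of both normals, \<open>\<bar>\<mu>\'\<bar> h = 1\<close>.\<close>
    define h where "h = mean_curvature \<epsilon> p A (parallel (\<mu> t)) Nt"
    have h: "h x > 0" for x using Nt by (simp add: inward_unit_normal_def h_def)
    have norm_Nt: "form (Nt x) (Nt x) = 1" for x
      using Nt by (simp add: inward_unit_normal_def unit_normal_def)
    have Nt_eq: "Nt x = - (\<mu>' * h x) *\<^sub>R ?N x" for x
    proof -
      have "\<mu>' *\<^sub>R ?N x = - (1 / h x) *\<^sub>R Nt x"
        using vector_derivative_unique_at[OF parallel_velocity[OF \<mu>] vel] by (simp add: h_def)
      then have "(- h x) *\<^sub>R (\<mu>' *\<^sub>R ?N x) = (- h x) *\<^sub>R (- (1 / h x) *\<^sub>R Nt x)" by (rule arg_cong)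
      then show ?thesis using h[of x] by (simp add: mult.commute)
    qed
    have sq: "(\<mu>' * h x)\<^sup>2 = 1" for x
      using norm_Nt[of x] P.form_N_N[of x] by (simp add: Nt_eq[of x] ambient_form_simps power2_eq_square)
    have nz: "\<mu>' \<noteq> 0" using sq by auto
    have abs: "\<bar>\<mu>'\<bar> * h x = 1" for x
      using sq[of x] h[of x] by (metis abs_mult abs_of_pos power2_eq_1_iff abs_1 abs_minus_cancel)
    have "- (\<mu>' * h x) = \<sigma>" for x
      using abs[of x] nz by (auto simp: \<sigma>_def sgn_if abs_if split: if_splits)
    then have "Nt = (\<lambda>x. \<sigma> *\<^sub>R ?N x)" using Nt_eq by (simp add: fun_eq_iff)
    then have "h x = \<sigma> * ?H x" for x using mean[OF nz] by (simp add: h_def)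
    then have "\<bar>\<mu>'\<bar> * \<sigma> * ?H x = 1" for x using abs[of x] by (simp add: mult.assoc)
    then show "\<forall>x. \<mu>' * ?H x = -1" unfolding \<sigma> by (simp add: minus_equation_iff eq_commute)
  next
    assume eq: "\<forall>x. \<mu>' * ?H x = -1"
    then have nz: "\<mu>' \<noteq> 0" by auto
    have H: "\<sigma> * ?H x = 1 / \<bar>\<mu>'\<bar>" for x
    proof -
      have "\<bar>\<mu>'\<bar> * (\<sigma> * ?H x) = - (\<mu>' * ?H x)" by (simp add: \<sigma>_def sgn_if abs_if)
      then show ?thesis using eq nz by (simp add: field_simps)
    qed
    show ?flow
    proof (intro exI[of _ "\<lambda>x. \<sigma> *\<^sub>R ?N x"] conjI allI)
      show "inward_unit_normal \<epsilon> p A (parallel (\<mu> t)) (\<lambda>x. \<sigma> *\<^sub>R ?N x)"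
        using scaled[OF nz] nz by (simp add: inward_unit_normal_def mean[OF nz] H)
      show "((\<lambda>s. parallel (\<mu> s) x) has_vector_derivative
         - (1 / mean_curvature \<epsilon> p A (parallel (\<mu> t)) (\<lambda>x. \<sigma> *\<^sub>R ?N x) x) *\<^sub>R \<sigma> *\<^sub>R ?N x) (at t)" for x
        using parallel_velocity[OF \<mu>, of x] by (simp add: mean[OF nz] H \<sigma>)
    qed
  qed
qed

lemma jacobian_exp_imp_flow_speed:
  assumes "open I" "t \<in> I" "(\<mu> has_real_derivative \<mu>') (at t)"
    and exp: "\<And>t x. t \<in> I \<Longrightarrow> jacobian x (\<mu> t) = exp t"
  shows "hypersurface \<epsilon> p A (parallel (\<mu> t))" "\<mu>' * parallel_mean_curvature (\<mu> t) x = -1"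
proof -
  show h: "hypersurface \<epsilon> p A (parallel (\<mu> t))"
    by (simp add: hypersurface_parallel_iff_jacobian exp[OF assms(2)])
  have "((\<lambda>t. jacobian x (\<mu> t)) has_real_derivative exp t) (at t)"
    using DERIV_exp[of t] has_field_derivative_transform_within_open[OF _ assms(1,2)] exp by metis
  from DERIV_unique[OF DERIV_jacobian[OF assms(3) h] this]
  have "- (\<mu>' * parallel_mean_curvature (\<mu> t) x) * exp t = exp t" by (simp add: exp[OF assms(2)])
  then have "(\<mu>' * parallel_mean_curvature (\<mu> t) x + 1) * exp t = 0" by (simp add: algebra_simps)
  then show "\<mu>' * parallel_mean_curvature (\<mu> t) x = -1" by (simp add: add_eq_0_iff2)
qed

lemma parallel_0: "parallel 0 = F"
  by (simp add: parallel_def[abs_def])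

lemma parallel_family_parallel:
  "parallel_family \<epsilon> F N I \<mu> Ft \<Longrightarrow> t \<in> I \<Longrightarrow> Ft t = parallel (\<mu> t)"
  by (simp add: parallel_family_def parallel_def fun_eq_iff)

lemma parallel_family_DERIV:
  assumes "parallel_family \<epsilon> F N I \<mu> Ft" "t \<in> I"
  obtains \<mu>' where "(\<mu> has_real_derivative \<mu>') (at t)"
proof -
  have "smooth_on I \<mu>" using assms(1) by (simp add: parallel_family_def)
  from smooth_on_differentiable[OF this assms(2)] show thesis
    by (rule real_differentiableE) (rule that)
qed

text \<open>By \<open>DERIV_jacobian\<close> the scalar flow equation \<open>\<mu>' H = -1\<close> says that \<open>J(\<mu>(t))\<close> equals its own
  derivative, and it starts at \<open>1\<close>. In the other direction \<open>J = e\<^sup>t \<noteq> 0\<close> also yields that the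
  parallel hypersurfaces are immersed.\<close>

lemma IMCF_solution_iff_jacobian:
  assumes I: "open_interval_around_0 I" and fam: "parallel_family \<epsilon> F N I \<mu> Ft" and \<mu>0: "\<mu> 0 = 0"
  shows "IMCF_solution \<epsilon> p A F I Ft \<longleftrightarrow> (\<forall>t\<in>I. \<forall>x. jacobian x (\<mu> t) = exp t)"
proof -
  have I': "open I" "0 \<in> I" "convex I"
    using I by (auto simp: open_interval_around_0_def is_interval_convex)
  have Ft: "Ft t = parallel (\<mu> t)" if "t \<in> I" for t by (rule parallel_family_parallel[OF fam that])
  have velocity: "((\<lambda>s. Ft s x) has_vector_derivative V) (at t) \<longleftrightarrow>
      ((\<lambda>s. parallel (\<mu> s) x) has_vector_derivative V) (at t)" if "t \<in> I" for t x V
    using that I'(1) Ft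
    by (auto intro: has_vector_derivative_transform_within_open[where S = I])
  have iff: "IMCF_solution \<epsilon> p A F I Ft \<longleftrightarrow>
     (\<forall>t\<in>I. hypersurface \<epsilon> p A (parallel (\<mu> t)) \<and>
        (\<exists>Nt. inward_unit_normal \<epsilon> p A (parallel (\<mu> t)) Nt \<and>
           (\<forall>x. ((\<lambda>s. parallel (\<mu> s) x) has_vector_derivative
                  - (1 / mean_curvature \<epsilon> p A (parallel (\<mu> t)) Nt x) *\<^sub>R Nt x) (at t))))"
    using I Ft[OF I'(2)] \<mu>0 parallel_0 by (simp add: IMCF_solution_def velocity Ft cong: ball_cong)
  show ?thesis
  proof
    assume sol: "IMCF_solution \<epsilon> p A F I Ft"
    have "((\<lambda>t. jacobian x (\<mu> t) * exp (- t)) has_real_derivative 0) (at t within I)" if t: "t \<in> I" for t x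
    proof -
      obtain \<mu>' where \<mu>': "(\<mu> has_real_derivative \<mu>') (at t)" by (rule parallel_family_DERIV[OF fam t])
      have h: "hypersurface \<epsilon> p A (parallel (\<mu> t))" using sol t unfolding iff by blast
      have "\<forall>x. \<mu>' * parallel_mean_curvature (\<mu> t) x = -1"
        unfolding parallel_flow_equation_iff[OF \<mu>' h, symmetric] using sol t unfolding iff by blast
      then have "((\<lambda>t. jacobian x (\<mu> t)) has_real_derivative jacobian x (\<mu> t)) (at t)"
        using DERIV_jacobian[OF \<mu>' h, of x] by simp
      then have "((\<lambda>t. jacobian x (\<mu> t) * exp (- t)) has_real_derivative 0) (at t)"
        by (auto intro!: derivative_eq_intros)
      then show ?thesis by (rule has_field_derivative_at_within)
    qed
    then have const: "\<exists>c. \<forall>t\<in>I. jacobian x (\<mu> t) * exp (- t) = c" for x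
      by (rule has_field_derivative_zero_constant[OF I'(3)])
    show "\<forall>t\<in>I. \<forall>x. jacobian x (\<mu> t) = exp t"
    proof (intro ballI allI)
      fix t x assume "t \<in> I"
      then have "jacobian x (\<mu> t) * exp (- t) = 1"
        using const[of x] I'(2) \<mu>0 parallel_jacobian_0[of \<epsilon> "curvatures x"] by fastforce
      then show "jacobian x (\<mu> t) = exp t" by (simp add: exp_minus field_simps)
    qed
  next
    assume J: "\<forall>t\<in>I. \<forall>x. jacobian x (\<mu> t) = exp t"
    show "IMCF_solution \<epsilon> p A F I Ft"
      unfolding iff
    proof
      fix t assume t: "t \<in> I"
      obtain \<mu>' where \<mu>': "(\<mu> has_real_derivative \<mu>') (at t)" by (rule parallel_family_DERIV[OF fam t])
      note speed = jacobian_exp_imp_flow_speed[OF I'(1) t \<mu>' J[rule_format]]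
      show "hypersurface \<epsilon> p A (parallel (\<mu> t)) \<and>
        (\<exists>Nt. inward_unit_normal \<epsilon> p A (parallel (\<mu> t)) Nt \<and>
           (\<forall>x. ((\<lambda>s. parallel (\<mu> s) x) has_vector_derivative
                  - (1 / mean_curvature \<epsilon> p A (parallel (\<mu> t)) Nt x) *\<^sub>R Nt x) (at t)))"
        using speed(1) speed(2) parallel_flow_equation_iff[OF \<mu>' speed(1)] by blast
    qed
  qed
qed

text \<open>On the sphere a parallel family determines \<open>\<mu>\<close> only up to the period of \<open>C\<close> and \<open>S\<close>, so \<open>\<mu>(0)\<close>
  may be any multiple of \<open>2\<pi>\<close>; in the other space forms it is \<open>0\<close>.\<close>

lemma parallel_family_normalize:
  assumes I: "open_interval_around_0 I" and fam: "parallel_family \<epsilon> F N I \<mu> Ft" and Ft0: "Ft 0 = F"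
  shows "parallel_family \<epsilon> F N I (\<lambda>t. \<mu> t - \<mu> 0) Ft"
proof -
  have I': "open I" "0 \<in> I" using I by (auto simp: open_interval_around_0_def)
  fix x
  have eq: "C (\<mu> 0) *\<^sub>R F x + S (\<mu> 0) *\<^sub>R N x = F x"
    using fam Ft0 I'(2) by (auto simp: parallel_family_def fun_eq_iff)
  have shift: "C (m - \<mu> 0) = C m \<and> S (m - \<mu> 0) = S m" for m
  proof (cases "\<epsilon> = 0")
    case True
    then have "\<mu> 0 *\<^sub>R N x = 0" using eq by (simp add: C_eps_def S_eps_def)
    moreover have "N x \<noteq> 0" using form_N_N[of x] by (auto simp: ambient_form_simps)
    ultimately show ?thesis by simp
  next
    case False
    have "form (N x) (C (\<mu> 0) *\<^sub>R F x + S (\<mu> 0) *\<^sub>R N x) = 0"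
      unfolding eq by (rule form_N_F[OF False])
    then have S0: "S (\<mu> 0) = 0" by (simp add: ambient_form_simps form_N_F[OF False] form_N_N)
    have "form (F x) (C (\<mu> 0) *\<^sub>R F x) = \<epsilon>"
      using form_F_F[OF False, of x] eq S0 by simp
    then have C0: "C (\<mu> 0) = 1" using False by (simp add: ambient_form_simps form_F_F[OF False])
    show ?thesis
      using S0 C0 eps False by (auto simp: C_eps_def S_eps_def cos_diff sin_diff)
  qed
  have "smooth_on I (\<lambda>t::real. 1::real)"
    by (rule smooth_on_if_closed_under_derivatives[OF I'(1), of "{\<lambda>_. 1, \<lambda>_. 0}"])
      (auto intro!: bexI[of _ "\<lambda>_. 0"])
  then have "smooth_on I (\<lambda>t. 1 *\<^sub>R \<mu> t + (- \<mu> 0) *\<^sub>R 1)"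
    using fam by (intro smooth_on_linear_combination I'(1)) (auto simp: parallel_family_def)
  then show ?thesis using fam shift by (simp add: parallel_family_def)
qed

lemma IMCF_solution_by_parallel_iff:
  assumes I: "open_interval_around_0 I"
  shows "IMCF_solution_by_parallel \<epsilon> p A F N I Ft \<longleftrightarrow>
    (\<exists>\<mu>. parallel_family \<epsilon> F N I \<mu> Ft \<and> \<mu> 0 = 0 \<and> (\<forall>t\<in>I. \<forall>x. jacobian x (\<mu> t) = exp t))"
proof
  assume sol: "IMCF_solution_by_parallel \<epsilon> p A F N I Ft"
  then obtain \<mu> where \<mu>: "parallel_family \<epsilon> F N I \<mu> Ft" and "Ft 0 = F"
    by (auto simp: IMCF_solution_by_parallel_def IMCF_solution_def)
  then have "parallel_family \<epsilon> F N I (\<lambda>t. \<mu> t - \<mu> 0) Ft" by (intro parallel_family_normalize[OF I])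
  moreover from IMCF_solution_iff_jacobian[OF I this] sol
  have "\<forall>t\<in>I. \<forall>x. jacobian x (\<mu> t - \<mu> 0) = exp t" by (simp add: IMCF_solution_by_parallel_def)
  ultimately show "\<exists>\<mu>. parallel_family \<epsilon> F N I \<mu> Ft \<and> \<mu> 0 = 0 \<and> (\<forall>t\<in>I. \<forall>x. jacobian x (\<mu> t) = exp t)"
    by (intro exI[of _ "\<lambda>t. \<mu> t - \<mu> 0"]) simp
next
  assume "\<exists>\<mu>. parallel_family \<epsilon> F N I \<mu> Ft \<and> \<mu> 0 = 0 \<and> (\<forall>t\<in>I. \<forall>x. jacobian x (\<mu> t) = exp t)"
  then show "IMCF_solution_by_parallel \<epsilon> p A F N I Ft"
    using IMCF_solution_iff_jacobian[OF I] unfolding IMCF_solution_by_parallel_def by blast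
qed

lemma solution_imp_isoparametric:
  assumes "IMCF_solution_by_parallel \<epsilon> p A F N I Ft"
  shows "isoparametric \<epsilon> p A F N"
proof -
  have I: "open_interval_around_0 I"
    using assms by (simp add: IMCF_solution_by_parallel_def IMCF_solution_def)
  then have I': "open I" "0 \<in> I" by (auto simp: open_interval_around_0_def)
  obtain \<mu> where fam: "parallel_family \<epsilon> F N I \<mu> Ft" and \<mu>0: "\<mu> 0 = 0"
    and J: "\<And>t x. t \<in> I \<Longrightarrow> jacobian x (\<mu> t) = exp t"
    using assms unfolding IMCF_solution_by_parallel_iff[OF I] by blast
  obtain \<mu>' where \<mu>': "(\<mu> has_real_derivative \<mu>') (at 0)" by (rule parallel_family_DERIV[OF fam I'(2)])
  have "\<mu>' \<noteq> 0" using jacobian_exp_imp_flow_speed(2)[OF I' \<mu>' J] by auto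
  then have "curvatures x = curvatures y" for x y
    using I' \<mu>0 \<mu>' J
    by (intro multiset_eq_if_parallel_jacobians_agree[OF eps, of _ _ I \<mu> \<mu>']) (auto simp: size_curvatures)
  then show ?thesis by (simp add: isoparametric_def)
qed

lemma isoparametric_imp_solution:
  assumes "isoparametric \<epsilon> p A F N" "\<And>x. mean_curvature \<epsilon> p A F N x > 0"
  shows "\<exists>I Ft. IMCF_solution_by_parallel \<epsilon> p A F N I Ft"
proof -
  fix x0
  obtain I \<mu> where I: "open_interval_around_0 I" and \<mu>: "smooth_on I \<mu>" "\<mu> 0 = 0"
    and J: "\<And>t. t \<in> I \<Longrightarrow> jacobian x0 (\<mu> t) = exp t"
    using parallel_jacobian_parametrization[OF eps assms(2)[of x0, unfolded mean_curvature_def]] by blast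
  have const: "curvatures x = curvatures x0" for x using assms(1) unfolding isoparametric_def by blast
  have "\<forall>t\<in>I. \<forall>x. jacobian x (\<mu> t) = exp t"
    using J by (subst const) blast
  moreover have "parallel_family \<epsilon> F N I \<mu> (\<lambda>t. parallel (\<mu> t))"
    using \<mu>(1) by (simp add: parallel_family_def parallel_def)
  ultimately have "IMCF_solution_by_parallel \<epsilon> p A F N I (\<lambda>t. parallel (\<mu> t))"
    unfolding IMCF_solution_by_parallel_iff[OF I] using \<mu>(2) by blast
  then show ?thesis by blast
qed

end

theorem theorem3p1:
  fixes \<epsilon> :: real
    and p :: "'q::finite"
    and A :: "('m::{t2_space,second_countable_topology}, 'n::finite) chart set"
    and F N :: "'m \<Rightarrow> real^'q"
  assumes "\<epsilon> \<in> {-1, 0, 1}"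
    and "CARD('q) = CARD('n) + (if \<epsilon> = 0 then 1 else 2)"
    and "smooth_atlas A"
    and "connected (UNIV :: 'm set)"
    and "hypersurface \<epsilon> p A F"
    and "inward_unit_normal \<epsilon> p A F N"
  shows "((\<exists>I Ft. IMCF_solution_by_parallel \<epsilon> p A F N I Ft) \<longleftrightarrow> isoparametric \<epsilon> p A F N) \<and>
    (isoparametric \<epsilon> p A F N \<longrightarrow>
      (\<forall>I Ft. open_interval_around_0 I \<longrightarrow>
        (IMCF_solution_by_parallel \<epsilon> p A F N I Ft \<longleftrightarrow>
          (\<exists>\<mu>. parallel_family \<epsilon> F N I \<mu> Ft \<and> \<mu> 0 = 0 \<and>
            (\<forall>t\<in>I. \<forall>x.
              (\<Prod>k\<in>#principal_curvatures \<epsilon> p A F N x. C_eps \<epsilon> (\<mu> t) - k * S_eps \<epsilon> (\<mu> t))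
                = exp t)))))"
proof -
  interpret oriented_hypersurface A \<epsilon> p F N
    by unfold_locales (use assms in \<open>auto simp: inward_unit_normal_def\<close>)
  have H: "mean_curvature \<epsilon> p A F N x > 0" for x
    using assms(6) by (simp add: inward_unit_normal_def)
  show ?thesis
    using solution_imp_isoparametric isoparametric_imp_solution[OF _ H] IMCF_solution_by_parallel_iff
    unfolding parallel_jacobian_def by blast
qed

end
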